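(* Let $\mu$ be an admissible probability measure on the free group $F_m=\langle a_1^{\pm1},\dots,a_m^{\pm1}\rangle$ generating an antisymmetric random walk, and let $\nu$ be its hitting measure on $\partial F_m$. Suppose there exists $1\le i\le m$ such that the singleton $\{a_j\}$ is an $a_j$-barrier for every $j\ne i$, and $\{a_i\}$ is an $a_i^2$-barrier. Then for each $j\neq i$ $$\rho_\mu(a_j)=F_\mu(e,a_j)=\frac{\nu(C(a_j))}{1-\nu(C(a_j))},$$ and $$\rho_\mu(a_i)=F_\mu(e,a_i)\le\frac{\nu(C(a_i))}{1-\nu(C(a_i))}.$$ Finally, the equality $$F_\mu(e,a_i)=\frac{\nu(C(a_i))}{1-\nu(C(a_i))}$$ holds if and only if $\{a_i\}$ is an $a_i$-barrier.
   Context: $F_m$ is the free group on $a_1,\dots,a_m$, with word length $|\cdot|$ with respect to $\{a_1^{\pm1},\dots,a_m^{\pm1}\}$. The random walk generated by a probability measure $\mu$ is $X_{k+1}=X_k s_{k+1}$ with $s_1,s_2,\dots$ i.i.d. of law $\mu$; $\mathbb P_x$ denotes its law when $X_0=x$. $\mu$ is admissible if $\operatorname{supp}(\mu)$ generates $F_m$ as a semigroup. Standing assumption: the walk is transient. Almost every sample path started at $e$ converges to a point of $\partial F_m$ (the space of geodesic rays in the Cayley tree starting from $e$); the hitting measure $\nu$ is the law of the limit point. $C(g)\subset\partial F_m$ is the set of geodesic rays starting from the identity and containing $g$, and $C_{fin}(g)=\{gx:\ |gx|=|g|+|x|\}\subset F_m$. Antisymmetric: let $g\mapsto\hat g$ be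 the automorphism of $F_m$ determined by $\hat a_i=a_i^{-1}$ for all $i$; the walk is antisymmetric if $\mu(g)=\mu(\hat g)$ for every $g\in F_m$. First-passage functions: $F_\mu(x,y)=\sum_{k\ge0}\mathbb P_x(X_k=y,\ X_j\ne y\text{ for }j<k)$, and for $S\subset F_m$, $y\notin S$, $F_\mu(x,y;S)=\sum_{k\ge0}\mathbb P_x(X_k=y,\ X_j\ne y\text{ and }X_j\notin S\text{ for all }j<k)$. When $h\in B$, $F_\mu(e,h;B)$ is understood to be $0$. Also $\rho_\mu(g):=\liminf_{k\to\infty}F_\mu(e,g^k)^{1/k}$. Barrier: for $g\in F_m\setminus\{e\}$, a subset $B\subseteq F_m$ is a $g$-barrier if $F_\mu(e,h;B)=0$ for every $h\in C_{fin}(g)$ (with the convention that $F_\mu(e,h;B)=0$ when $h\in B$, this is a condition only on $h\in C_{fin}(g)\setminus B$). *)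

theory Defs
  imports "HOL-Algebra.Group" "HOL-Probability.Probability"
begin

section \<open>The free group of rank \<open>m\<close>\<close>

text \<open>The letter \<open>(i, True)\<close> stands for \<open>a\<^sub>i\<close> and \<open>(i, False)\<close> for its inverse.  Elements of the free
  group are reduced words, so that the word length with respect to the letters is the
  length of the list.\<close>

type_synonym letter = "nat \<times> bool"
type_synonym word = "letter list"

definition flip :: "letter \<Rightarrow> letter" where
  "flip x = (fst x, \<not> snd x)"

definition reduced_word :: "word \<Rightarrow> bool" where
  "reduced_word w \<longleftrightarrow> successively (\<lambda>x y. y \<noteq> flip x) w"

fun push :: "letter \<Rightarrow> word \<Rightarrow> word" where
  "push x [] = [x]"
| "push x (y # ys) = (if y = flip x then ys else x # y # ys)"

definition free_group :: "nat \<Rightarrow> word monoid" where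
  "free_group m =
     \<lparr> carrier = {w. reduced_word w \<and> fst ` set w \<subseteq> {1..m}},
       monoid.mult = (\<lambda>u v. foldr push u v),
       one = [] \<rparr>"

definition gen :: "nat \<Rightarrow> word" where
  "gen i = [(i, True)]"

text \<open>The automorphism sending every \<open>a\<^sub>i\<close> to its inverse (see \<open>hat_iso\<close>, \<open>hat_gen\<close> below).\<close>

definition hat :: "word \<Rightarrow> word" where
  "hat w = map flip w"

lemma flip_flip [simp]: "flip (flip x) = x"
  and fst_flip [simp]: "fst (flip x) = fst x"
  and flip_neq [simp]: "flip x \<noteq> x" "x \<noteq> flip x"
  by (auto simp: flip_def prod_eq_iff)

lemma flip_eq_iff [simp]: "flip x = flip y \<longleftrightarrow> x = y"
  by (metis flip_flip)

lemma reduced_Nil [simp]: "reduced_word []"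
  by (simp add: reduced_word_def)

lemma reduced_Cons: "reduced_word (x # w) \<longleftrightarrow> reduced_word w \<and> (w \<noteq> [] \<longrightarrow> hd w \<noteq> flip x)"
  by (cases w) (auto simp: reduced_word_def)

lemma reduced_push: "reduced_word w \<Longrightarrow> reduced_word (push x w)"
  by (cases w) (auto simp: reduced_Cons)

lemma reduced_foldr_push: "reduced_word w \<Longrightarrow> reduced_word (foldr push u w)"
  by (induction u) (auto intro: reduced_push)

lemma set_push: "set (push x w) \<subseteq> insert x (set w)"
  by (cases w) auto

lemma set_foldr_push: "set (foldr push u w) \<subseteq> set u \<union> set w"
proof (induction u)
  case (Cons x u)
  then show ?case using set_push[of x "foldr push u w"] by auto
qed simp

lemma push_flip: "reduced_word w \<Longrightarrow> push x (push (flip x) w) = w"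
proof (cases w)
  case (Cons y ys)
  assume "reduced_word w"
  with Cons show ?thesis by (cases ys) (auto simp: reduced_Cons)
qed simp

lemma foldr_push_push:
  "reduced_word w \<Longrightarrow> foldr push (push x v) w = push x (foldr push v w)"
  by (cases v) (auto simp: push_flip reduced_foldr_push)

lemma foldr_push_assoc:
  "reduced_word w \<Longrightarrow> foldr push (foldr push u v) w = foldr push u (foldr push v w)"
  by (induction u) (auto simp: foldr_push_push)

lemma foldr_push_Nil: "reduced_word u \<Longrightarrow> foldr push u [] = u"
proof (induction u)
  case (Cons x u)
  then show ?case by (cases u) (auto simp: reduced_Cons)
qed simp

lemma foldr_push_inverse:
  "reduced_word w \<Longrightarrow> foldr push (rev (map flip u)) (foldr push u w) = w"
proof (induction u arbitrary: w)
  case (Cons x u)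
  then show ?case
    using push_flip[of "foldr push u w" "flip x"] by (simp add: reduced_foldr_push)
qed simp

lemma free_group_sel:
  "carrier (free_group m) = {w. reduced_word w \<and> fst ` set w \<subseteq> {1..m}}"
  "u \<otimes>\<^bsub>free_group m\<^esub> v = foldr push u v"
  "\<one>\<^bsub>free_group m\<^esub> = []"
  by (simp_all add: free_group_def)

lemma foldr_push_closed:
  assumes "u \<in> carrier (free_group m)" "v \<in> carrier (free_group m)"
  shows "foldr push u v \<in> carrier (free_group m)"
  using assms set_foldr_push[of u v] reduced_foldr_push[of v u]
  by (fastforce simp: free_group_sel)

lemma group_free_group: "group (free_group m)"
proof (rule groupI)
  fix u assume u: "u \<in> carrier (free_group m)"
  define v where "v = foldr push (rev (map flip u)) []"
  have "foldr push v u = foldr push (rev (map flip u)) (foldr push u [])"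
    using u by (simp add: v_def foldr_push_assoc foldr_push_Nil free_group_sel)
  then have "foldr push v u = []" by (simp add: foldr_push_inverse)
  moreover have "set v \<subseteq> flip ` set u"
    using set_foldr_push[of "rev (map flip u)" "[]"] by (simp add: v_def)
  then have "fst ` set v \<subseteq> fst ` set u"
    by (force simp: image_image dest!: image_mono[where f = fst])
  then have "fst ` set v \<subseteq> {1..m}"
    using u unfolding free_group_sel(1) by blast
  then have "v \<in> carrier (free_group m)"
    by (simp add: free_group_sel(1) v_def reduced_foldr_push)
  ultimately show "\<exists>v\<in>carrier (free_group m). v \<otimes>\<^bsub>free_group m\<^esub> u = \<one>\<^bsub>free_group m\<^esub>"
    by (auto simp: free_group_sel)
next
  fix u v assume "u \<in> carrier (free_group m)" "v \<in> carrier (free_group m)"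
  then show "u \<otimes>\<^bsub>free_group m\<^esub> v \<in> carrier (free_group m)"
    unfolding free_group_sel(2) by (rule foldr_push_closed)
qed (auto simp: free_group_sel foldr_push_assoc)

lemma gen_in_carrier: "i \<in> {1..m} \<Longrightarrow> gen i \<in> carrier (free_group m)"
  by (simp add: gen_def free_group_sel reduced_Cons)

lemma hat_hat: "hat (hat w) = w"
  by (simp add: hat_def comp_def)

lemma hat_closed: "w \<in> carrier (free_group m) \<Longrightarrow> hat w \<in> carrier (free_group m)"
proof -
  have "reduced_word w \<Longrightarrow> reduced_word (map flip w)" for w
    by (induction w) (simp_all add: reduced_Cons hd_map, metis flip_flip)
  then show "w \<in> carrier (free_group m) \<Longrightarrow> hat w \<in> carrier (free_group m)"
    by (auto simp: free_group_sel hat_def image_image)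
qed

lemma hat_iso: "hat \<in> iso (free_group m) (free_group m)"
proof -
  have "map flip (push x w) = push (flip x) (map flip w)" for x w
    by (cases w) auto
  then have "hat (foldr push u v) = foldr push (hat u) (hat v)" for u v
    by (induction u) (auto simp: hat_def)
  then have "hat \<in> hom (free_group m) (free_group m)"
    by (auto simp: hom_def hat_closed free_group_sel(2))
  moreover have "bij_betw hat (carrier (free_group m)) (carrier (free_group m))"
    by (rule bij_betw_byWitness[where f' = hat]) (auto simp: hat_hat hat_closed)
  ultimately show ?thesis by (simp add: iso_def)
qed

lemma hat_gen:
  assumes "i \<in> {1..m}"
  shows "hat (gen i) = inv\<^bsub>free_group m\<^esub> (gen i)"
proof -
  interpret group "free_group m" by (rule group_free_group)
  have "hat (gen i) \<otimes>\<^bsub>free_group m\<^esub> gen i = \<one>\<^bsub>free_group m\<^esub>"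
    by (simp add: free_group_sel hat_def gen_def)
  then show ?thesis
    using inv_equality gen_in_carrier[OF assms] hat_closed by metis
qed


section \<open>The random walk\<close>

text \<open>Probability measures on the countable group are probability mass functions.  The
  i.i.d. increments \<open>s\<^sub>1, s\<^sub>2, \<dots>\<close> are the entries of a random stream, with \<open>s\<^sub>k\<^sub>+\<^sub>1\<close> at position \<open>k\<close>.\<close>

primrec walk :: "nat \<Rightarrow> word \<Rightarrow> word stream \<Rightarrow> nat \<Rightarrow> word" where
  "walk m x s 0 = x"
| "walk m x s (Suc k) = walk m x s k \<otimes>\<^bsub>free_group m\<^esub> (s !! k)"

abbreviation increments :: "word pmf \<Rightarrow> word stream measure" where
  "increments \<mu> \<equiv> stream_space (measure_pmf \<mu>)"

inductive_set semigroup_span :: "('a, 'b) monoid_scheme \<Rightarrow> 'a set \<Rightarrow> 'a set"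
  for G (structure) and S where
  incl: "s \<in> S \<Longrightarrow> s \<in> semigroup_span G S"
| mult: "x \<in> semigroup_span G S \<Longrightarrow> y \<in> semigroup_span G S \<Longrightarrow> x \<otimes> y \<in> semigroup_span G S"

definition admissible :: "nat \<Rightarrow> word pmf \<Rightarrow> bool" where
  "admissible m \<mu> \<longleftrightarrow>
     set_pmf \<mu> \<subseteq> carrier (free_group m) \<and>
     semigroup_span (free_group m) (set_pmf \<mu>) = carrier (free_group m)"

definition transient :: "nat \<Rightarrow> word pmf \<Rightarrow> bool" where
  "transient m \<mu> \<longleftrightarrow>
     (\<forall>x\<in>carrier (free_group m). \<P>(s in increments \<mu>. \<exists>k\<ge>1. walk m x s k = x) < 1)"

definition antisymmetric :: "nat \<Rightarrow> word pmf \<Rightarrow> bool" where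
  "antisymmetric m \<mu> \<longleftrightarrow> (\<forall>g\<in>carrier (free_group m). pmf \<mu> g = pmf \<mu> (hat g))"

definition first_passage :: "nat \<Rightarrow> word pmf \<Rightarrow> word \<Rightarrow> word \<Rightarrow> real" where
  "first_passage m \<mu> x y =
     (\<Sum>k. \<P>(s in increments \<mu>. walk m x s k = y \<and> (\<forall>j<k. walk m x s j \<noteq> y)))"

definition first_passage_avoiding :: "nat \<Rightarrow> word pmf \<Rightarrow> word \<Rightarrow> word \<Rightarrow> word set \<Rightarrow> real" where
  "first_passage_avoiding m \<mu> x y S =
     (if y \<in> S then 0
      else (\<Sum>k. \<P>(s in increments \<mu>.
              walk m x s k = y \<and> (\<forall>j<k. walk m x s j \<noteq> y \<and> walk m x s j \<notin> S))))"

definition rho :: "nat \<Rightarrow> word pmf \<Rightarrow> word \<Rightarrow> ereal" where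
  "rho m \<mu> g =
     liminf (\<lambda>k. ereal (root k (first_passage m \<mu> \<one>\<^bsub>free_group m\<^esub> (g [^]\<^bsub>free_group m\<^esub> k))))"

definition C_fin :: "nat \<Rightarrow> word \<Rightarrow> word set" where
  "C_fin m g = {g \<otimes>\<^bsub>free_group m\<^esub> x | x.
     x \<in> carrier (free_group m) \<and> length (g \<otimes>\<^bsub>free_group m\<^esub> x) = length g + length x}"

definition barrier :: "nat \<Rightarrow> word pmf \<Rightarrow> word \<Rightarrow> word set \<Rightarrow> bool" where
  "barrier m \<mu> g B \<longleftrightarrow>
     g \<in> carrier (free_group m) - {\<one>\<^bsub>free_group m\<^esub>} \<and> B \<subseteq> carrier (free_group m) \<and>
     (\<forall>h\<in>C_fin m g. first_passage_avoiding m \<mu> \<one>\<^bsub>free_group m\<^esub> h B = 0)"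


section \<open>The boundary and the hitting measure\<close>

definition boundary :: "nat \<Rightarrow> (nat \<Rightarrow> word) set" where
  "boundary m = {\<xi>. range \<xi> \<subseteq> carrier (free_group m) \<and> \<xi> 0 = \<one>\<^bsub>free_group m\<^esub> \<and>
     (\<forall>j k. j \<le> k \<longrightarrow> length (inv\<^bsub>free_group m\<^esub> (\<xi> j) \<otimes>\<^bsub>free_group m\<^esub> \<xi> k) = k - j)}"

definition cylinder :: "nat \<Rightarrow> word \<Rightarrow> (nat \<Rightarrow> word) set" where
  "cylinder m g = {\<xi> \<in> boundary m. g \<in> range \<xi>}"

text \<open>The cylinders form a countable base of the topology of the boundary, so they generate
  its Borel sets.\<close>

definition boundary_space :: "nat \<Rightarrow> (nat \<Rightarrow> word) measure" where
  "boundary_space m = sigma (boundary m) (cylinder m ` carrier (free_group m))"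

text \<open>Convergence in the compactification of the Cayley tree by its boundary, in which the sets
  \<open>C_fin m g \<union> cylinder m g\<close>, for \<open>g\<close> on the ray \<open>\<xi>\<close>, form a neighbourhood base of \<open>\<xi>\<close>.\<close>

definition converges_to :: "nat \<Rightarrow> (nat \<Rightarrow> word) \<Rightarrow> (nat \<Rightarrow> word) \<Rightarrow> bool" where
  "converges_to m X \<xi> \<longleftrightarrow> (\<forall>n. \<forall>\<^sub>F k in sequentially. X k \<in> C_fin m (\<xi> n))"

text \<open>Sequences without a limit get an arbitrary point of the boundary, so that \<open>limit_point\<close> is
  a measurable map into \<open>boundary_space m\<close> for \<open>m \<ge> 1\<close>.\<close>

definition limit_point :: "nat \<Rightarrow> (nat \<Rightarrow> word) \<Rightarrow> (nat \<Rightarrow> word)" where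
  "limit_point m X =
     (if \<exists>\<xi>\<in>boundary m. converges_to m X \<xi>
      then THE \<xi>. \<xi> \<in> boundary m \<and> converges_to m X \<xi>
      else (\<lambda>n. gen 1 [^]\<^bsub>free_group m\<^esub> n))"

definition hitting_measure :: "nat \<Rightarrow> word pmf \<Rightarrow> (nat \<Rightarrow> word) measure" where
  "hitting_measure m \<mu> =
     distr (increments \<mu>) (boundary_space m) (\<lambda>s. limit_point m (walk m \<one>\<^bsub>free_group m\<^esub> s))"

end

theory Submission
  imports Defs
begin

text \<open>Let \<open>y\<close> be a letter \<open>a\<^sub>j\<close> or its inverse, write \<open>N(y)\<close> for the probability that the walk from the
identity \<open>e\<close> ends up beyond \<open>y\<close>, that is, that its limit point lies in the cylinder of \<open>y\<close>, and \<open>F(y)\<close>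
for the probability that it ever visits \<open>y\<close>.

Stop the walk at its first visit to \<open>y\<close>.  Seen from \<open>y\<close>, the ends beyond \<open>y\<close> are those that are
not beyond \<open>y\<^sup>-\<^sup>1\<close>, so by the strong Markov property the walk visits \<open>y\<close> and ends up beyond
it with probability \<open>F(y) (1 - N(y\<^sup>-\<^sup>1))\<close>.  The antisymmetry yields \<open>N(y\<^sup>-\<^sup>1) = N(y)\<close>.  Hence
\<open>N(y) = F(y) (1 - N(y)) + R(y)\<close> where \<open>R(y)\<close> is the probability to end up beyond \<open>y\<close> without ever
visiting \<open>y\<close> (\<open>end_prob_letter\<close>).  As \<open>N(y) = N(y\<^sup>-\<^sup>1)\<close> forces \<open>N(y) \<le> 1/2\<close>, all assertions on the
hitting measure amount to this: \<open>R(a\<^sub>j) = 0\<close> if and only if \<open>{a\<^sub>j}\<close> is an \<open>a\<^sub>j\<close>-barrier.  If it is a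
barrier, then \<open>R(a\<^sub>j) = 0\<close> at once.

The converse, and the very existence of limit points, rest on a rigidity of the walk at the
barriers.  A barrier at \<open>y\<close> is a statement on paths from \<open>e\<close> only.  But since every point can be
reached from \<open>e\<close>, the barrier at \<open>y\<close> together with its mirror image at \<open>y\<^sup>-\<^sup>1\<close> implies that
from anywhere in the complement, the half-tree beyond \<open>y\<close> can be entered at \<open>y\<close> only
(\<open>gated_letter.enters_only_at_letter\<close>).  By translation, all edges of the Cayley tree with a label \<open>a\<^sub>j\<close>,
\<open>j \<noteq> i\<close>, can be crossed only by landing on their far endpoint.  Applied to single
increments, this shows that increments have length at most two (\<open>support_length\<close>).  A transient walk
leaves every finite set, and in a tree such a path with bounded steps converges to an end.

Suppose now that \<open>{a\<^sub>i}\<close> is not an \<open>a\<^sub>i\<close>-barrier.  Some path then reaches a word beyond \<open>a\<^sub>i\<close> while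
avoiding \<open>a\<^sub>i\<close>.  As \<open>{a\<^sub>i}\<close> is an \<open>a\<^sub>i\<^sup>2\<close>-barrier, the second letter \<open>z\<close> of that word belongs to some
\<open>a\<^sub>j\<close> with \<open>j \<noteq> i\<close>, and so the path has entered the half-tree beyond \<open>a\<^sub>i z\<close> at \<open>a\<^sub>i z\<close>.  From there
transience allows the walk never to visit \<open>a\<^sub>i\<close>, with positive probability; but \<open>a\<^sub>i\<close> is the only exit
from the half-tree, so its limit point lies beyond \<open>a\<^sub>i\<close>, and \<open>R(a\<^sub>i) > 0\<close>
(\<open>unhit_end_prob_pos\<close>).

Finally, for every \<open>j\<close> and \<open>k \<ge> 2\<close> the walk can reach \<open>a\<^sub>j\<^sup>k\<close> only through \<open>a\<^sub>j\<close>, for \<open>j = i\<close> by the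
\<open>a\<^sub>i\<^sup>2\<close>-barrier.  So the probability to visit \<open>a\<^sub>j\<^sup>k\<close> is \<open>F(a\<^sub>j)\<^sup>k\<close>, whose \<open>k\<close>-th root is constant.\<close>

section \<open>Reduced words\<close>

lemma foldr_push_reduced_append: "reduced_word (u @ v) \<Longrightarrow> foldr push u v = u @ v"
proof (induction u)
  case (Cons x u)
  then show ?case by (cases "u @ v") (auto simp: reduced_Cons)
qed simp

lemma length_push_le: "length (push x w) \<le> Suc (length w)"
  by (cases w) auto

lemma length_foldr_push_le: "length (foldr push u v) \<le> length u + length v"
proof (induction u)
  case (Cons x u)
  then show ?case using length_push_le[of x "foldr push u v"] by simp
qed simp

lemma foldr_push_no_cancellation:
  "length (foldr push u v) = length u + length v \<Longrightarrow> foldr push u v = u @ v"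
proof (induction u)
  case (Cons x u)
  let ?w = "foldr push u v"
  have eq: "length (push x ?w) = Suc (length u + length v)" using Cons.prems by simp
  have "length ?w = length u + length v"
    using eq length_push_le[of x ?w] length_foldr_push_le[of u v] by linarith
  moreover have "push x ?w = x # ?w" using eq calculation by (cases ?w) (auto split: if_splits)
  ultimately show ?case using Cons.IH by simp
qed simp

text \<open>Lengths can only add up in a product when nothing cancels.\<close>

lemma C_fin_iff_take:
  assumes "g \<in> carrier (free_group m)"
  shows "w \<in> C_fin m g \<longleftrightarrow> w \<in> carrier (free_group m) \<and> take (length g) w = g"
proof
  assume "w \<in> C_fin m g"
  then obtain x where x: "w = g \<otimes>\<^bsub>free_group m\<^esub> x" "x \<in> carrier (free_group m)"
      "length w = length g + length x"
    by (auto simp: C_fin_def)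
  then have "w = g @ x" by (metis foldr_push_no_cancellation free_group_sel(2))
  moreover have "w \<in> carrier (free_group m)"
    using x assms foldr_push_closed[of g m x] by (simp add: free_group_sel(2))
  ultimately show "w \<in> carrier (free_group m) \<and> take (length g) w = g"
    by simp
next
  assume w: "w \<in> carrier (free_group m) \<and> take (length g) w = g"
  define x where "x = drop (length g) w"
  have wx: "w = g @ x" using w by (metis append_take_drop_id x_def)
  have "x \<in> carrier (free_group m)"
    using w wx by (auto simp: free_group_sel(1) reduced_word_def successively_append_iff)
  moreover have "g \<otimes>\<^bsub>free_group m\<^esub> x = g @ x"
    using w wx foldr_push_reduced_append[of g x] by (simp add: free_group_sel)
  ultimately show "w \<in> C_fin m g" unfolding C_fin_def using wx by (auto intro!: exI[of _ x])
qed

lemma C_fin_letter: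
  assumes "[y] \<in> carrier (free_group m)"
  shows "w \<in> C_fin m [y] \<longleftrightarrow> w \<in> carrier (free_group m) \<and> w \<noteq> [] \<and> hd w = y"
  unfolding C_fin_iff_take[OF assms] by (cases w) auto

lemma letter_in_carrier: "[y] \<in> carrier (free_group m) \<longleftrightarrow> fst y \<in> {1..m}"
  by (auto simp: free_group_sel reduced_Cons)

lemma flip_letter_in_carrier:
  "[y] \<in> carrier (free_group m) \<Longrightarrow> [flip y] \<in> carrier (free_group m)"
  by (simp add: letter_in_carrier)

text \<open>Multiplying by \<open>y\<^sup>-\<^sup>1\<close> exchanges the two half-trees that the edge at \<open>y\<close> separates.\<close>

lemma letter_mult_in_C_fin_flip:
  assumes "[y] \<in> carrier (free_group m)" "x \<in> carrier (free_group m)"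
  shows "[flip y] \<otimes>\<^bsub>free_group m\<^esub> x \<in> C_fin m [flip y] \<longleftrightarrow> x \<notin> C_fin m [y]"
proof -
  have c: "[flip y] \<otimes>\<^bsub>free_group m\<^esub> x \<in> carrier (free_group m)"
    using foldr_push_closed[OF flip_letter_in_carrier[OF assms(1)] assms(2)]
    by (simp add: free_group_sel(2))
  show ?thesis
    unfolding C_fin_letter[OF assms(1)] C_fin_letter[OF flip_letter_in_carrier[OF assms(1)]]
    using c assms(2) by (cases x) (auto simp: free_group_sel(2) free_group_sel(1) reduced_Cons)
qed

lemma in_C_fin_append_letter:
  assumes "w @ [y] \<in> carrier (free_group m)" "x \<in> carrier (free_group m)"
  shows "x \<in> C_fin m (w @ [y]) \<longleftrightarrow> inv\<^bsub>free_group m\<^esub> w \<otimes>\<^bsub>free_group m\<^esub> x \<in> C_fin m [y]"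
proof -
  interpret group "free_group m" by (rule group_free_group)
  have w: "w \<in> carrier (free_group m)" and y: "[y] \<in> carrier (free_group m)"
    using assms(1) by (auto simp: free_group_sel(1) reduced_word_def successively_append_iff)
  show ?thesis
  proof
    assume "x \<in> C_fin m (w @ [y])"
    then have "take (length (w @ [y])) x = w @ [y]"
      using C_fin_iff_take[OF assms(1)] by blast
    then obtain v where v: "x = w @ y # v"
      by (metis append_take_drop_id append.assoc append_Cons append_Nil)
    have yv: "y # v \<in> carrier (free_group m)"
      using assms(2) v by (auto simp: free_group_sel(1) reduced_word_def successively_append_iff)
    have "w \<otimes>\<^bsub>free_group m\<^esub> (y # v) = x"
      using assms(2) v foldr_push_reduced_append[of w "y # v"] by (simp add: free_group_sel)
    then have "inv\<^bsub>free_group m\<^esub> w \<otimes>\<^bsub>free_group m\<^esub> x = y # v"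
      using inv_solve_left'[of "y # v" w x] w yv assms(2) by simp
    then show "inv\<^bsub>free_group m\<^esub> w \<otimes>\<^bsub>free_group m\<^esub> x \<in> C_fin m [y]"
      using yv C_fin_letter[OF y] by simp
  next
    assume *: "inv\<^bsub>free_group m\<^esub> w \<otimes>\<^bsub>free_group m\<^esub> x \<in> C_fin m [y]"
    then obtain v where v: "inv\<^bsub>free_group m\<^esub> w \<otimes>\<^bsub>free_group m\<^esub> x = y # v"
        and yv: "y # v \<in> carrier (free_group m)"
      using C_fin_letter[OF y] by (metis list.collapse)
    have "x = w \<otimes>\<^bsub>free_group m\<^esub> (y # v)"
      using inv_solve_left'[of "y # v" w x] v w yv assms(2) by simp
    moreover have "reduced_word (w @ y # v)"
      using assms(1) yv
      by (auto simp: free_group_sel(1) reduced_word_def successively_append_iff successively_Cons)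
    ultimately have "x = w @ y # v"
      using foldr_push_reduced_append by (simp add: free_group_sel(2))
    then show "x \<in> C_fin m (w @ [y])"
      using C_fin_iff_take[OF assms(1)] assms(2) by simp
  qed
qed

lemma hat_mult: "hat (u \<otimes>\<^bsub>free_group m\<^esub> v) = hat u \<otimes>\<^bsub>free_group m\<^esub> hat v"
proof -
  have "map flip (push x w) = push (flip x) (map flip w)" for x w
    by (cases w) auto
  then show ?thesis
    unfolding free_group_sel(2) by (induction u) (auto simp: hat_def)
qed

lemma hat_in_carrier_iff: "hat w \<in> carrier (free_group m) \<longleftrightarrow> w \<in> carrier (free_group m)"
  by (metis hat_closed hat_hat)

lemma hat_in_C_fin:
  assumes "g \<in> carrier (free_group m)"
  shows "hat w \<in> C_fin m (hat g) \<longleftrightarrow> w \<in> C_fin m g"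
  unfolding C_fin_iff_take[OF assms] C_fin_iff_take[OF hat_closed[OF assms]] hat_in_carrier_iff
  by (simp add: hat_def take_map inj_map_eq_map inj_def)

lemma foldr_push_letter:
  assumes "reduced_word w"
  shows "foldr push w [y] = (if w \<noteq> [] \<and> last w = flip y then butlast w else w @ [y])"
proof (cases "w \<noteq> [] \<and> last w = flip y")
  case True
  then have w: "w = butlast w @ [flip y]" by (metis append_butlast_last_id)
  have "reduced_word (butlast w)"
    using assms w by (metis reduced_word_def successively_append_iff)
  moreover have "foldr push w [y] = foldr push (butlast w) (push (flip y) [y])"
    by (subst w) simp
  ultimately show ?thesis using True by (simp add: foldr_push_Nil)
next
  case False
  then have "reduced_word (w @ [y])"
    using assms flip_flip by (auto simp: reduced_word_def successively_append_iff)
  then show ?thesis using False foldr_push_reduced_append by auto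
qed

text \<open>Cancellation proceeds letter by letter from the end of \<open>w\<close>, so a short increment leaves a prefix of a long
word alone.\<close>

lemma take_mult_short:
  assumes "w \<in> carrier (free_group m)" "s \<in> carrier (free_group m)" "length s + n \<le> length w"
  shows "take n (w \<otimes>\<^bsub>free_group m\<^esub> s) = take n w"
proof -
  have "reduced_word w \<Longrightarrow> reduced_word s \<Longrightarrow> length s + n \<le> length w
      \<Longrightarrow> take n (foldr push w s) = take n w"
  proof (induction s arbitrary: w)
    case Nil then show ?case by (simp add: foldr_push_Nil)
  next
    case (Cons y s)
    define w' where "w' = foldr push w [y]"
    have w'_eq: "w' = (if w \<noteq> [] \<and> last w = flip y then butlast w else w @ [y])"
      unfolding w'_def by (rule foldr_push_letter) fact
    have "push y s = y # s" using Cons.prems(2) by (cases s) (auto simp: reduced_Cons)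
    then have "foldr push w (y # s) = foldr push w (foldr push [y] s)" by simp
    also have "\<dots> = foldr push w' s"
      unfolding w'_def using Cons.prems(2) by (intro foldr_push_assoc[symmetric]) (simp add: reduced_Cons)
    finally have "foldr push w (y # s) = foldr push w' s" .
    moreover have "take n (foldr push w' s) = take n w'"
    proof (rule Cons.IH)
      show "reduced_word w'" unfolding w'_def by (rule reduced_foldr_push) (simp add: reduced_Cons)
      show "reduced_word s" using Cons.prems(2) by (simp add: reduced_Cons)
      show "length s + n \<le> length w'" using Cons.prems(3) by (auto simp: w'_eq)
    qed
    moreover have "take n w' = take n w"
      using Cons.prems(3) by (auto simp: w'_eq take_butlast)
    ultimately show ?case by simp
  qed
  then show ?thesis using assms by (simp add: free_group_sel)
qed

lemma gen_pow: "gen j [^]\<^bsub>free_group m\<^esub> k = replicate k (j, True)"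
proof -
  have red: "reduced_word (replicate k (j, True))" for k
    by (induction k) (auto simp: reduced_Cons flip_def hd_replicate)
  show ?thesis
  proof (induction k)
    case 0 then show ?case by (simp add: nat_pow_def free_group_sel(3))
  next
    case (Suc k)
    have "gen j [^]\<^bsub>free_group m\<^esub> Suc k = replicate k (j, True) \<otimes>\<^bsub>free_group m\<^esub> gen j"
      using Suc by (simp add: nat_pow_def)
    also have "\<dots> = replicate k (j, True) @ [(j, True)]"
      unfolding gen_def free_group_sel(2)
      by (rule foldr_push_reduced_append) (use red[of "Suc k"] in \<open>simp add: replicate_append_same\<close>)
    finally show ?case by (simp add: replicate_append_same)
  qed
qed

lemma gen_pow_in_carrier:
  "j \<in> {1..m} \<Longrightarrow> gen j [^]\<^bsub>free_group m\<^esub> (k::nat) \<in> carrier (free_group m)"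
  using group_free_group[of m] gen_in_carrier
  by (intro monoid.nat_pow_closed) (auto simp: group_def)

lemma gen_pow_in_C_fin:
  fixes n k :: nat
  assumes "j \<in> {1..m}" "n \<le> k"
  shows "gen j [^]\<^bsub>free_group m\<^esub> k \<in> C_fin m (gen j [^]\<^bsub>free_group m\<^esub> n)"
  unfolding C_fin_iff_take[OF gen_pow_in_carrier[OF assms(1)]]
  using gen_pow_in_carrier[OF assms(1), of k] assms(2) by (simp add: gen_pow)

section \<open>Paths with increments in the support\<close>

definition endpoint :: "nat \<Rightarrow> word \<Rightarrow> word list \<Rightarrow> word" where
  "endpoint m x ss = foldl (\<lambda>u v. u \<otimes>\<^bsub>free_group m\<^esub> v) x ss"

lemma endpoint_Nil [simp]: "endpoint m x [] = x"
  and endpoint_append: "endpoint m x (ss @ ts) = endpoint m (endpoint m x ss) ts"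
  and endpoint_snoc: "endpoint m x (ss @ [t]) = endpoint m x ss \<otimes>\<^bsub>free_group m\<^esub> t"
  by (simp_all add: endpoint_def)

lemma endpoint_in_carrier:
  assumes "x \<in> carrier (free_group m)" "set ss \<subseteq> carrier (free_group m)"
  shows "endpoint m x ss \<in> carrier (free_group m)"
  using assms(2)
proof (induction ss rule: rev_induct)
  case (snoc s ss)
  then show ?case
    using foldr_push_closed[of "endpoint m x ss" m s] by (simp add: endpoint_snoc free_group_sel(2))
qed (simp add: assms)

lemma endpoint_translate:
  assumes "g \<in> carrier (free_group m)" "x \<in> carrier (free_group m)"
    and "set ss \<subseteq> carrier (free_group m)"
  shows "endpoint m (g \<otimes>\<^bsub>free_group m\<^esub> x) ss = g \<otimes>\<^bsub>free_group m\<^esub> endpoint m x ss"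
proof -
  interpret group "free_group m" by (rule group_free_group)
  show ?thesis using assms(3)
  proof (induction ss rule: rev_induct)
    case (snoc s ss)
    then show ?case
      using assms endpoint_in_carrier[OF assms(2), of ss] by (simp add: endpoint_snoc m_assoc)
  qed simp
qed

lemma hat_endpoint: "hat (endpoint m x ss) = endpoint m (hat x) (map hat ss)"
  by (induction ss rule: rev_induct) (simp_all add: endpoint_snoc hat_mult)

lemma walk_eq_endpoint: "walk m x s k = endpoint m x (stake k s)"
  by (induction k) (simp_all add: stake_Suc endpoint_snoc del: stake.simps(2))

lemma walk_add: "walk m x s (k + n) = walk m (walk m x s k) (sdrop k s) n"
  by (simp add: walk_eq_endpoint endpoint_append[symmetric] del: endpoint_def)

lemma walk_in_carrier:
  assumes "x \<in> carrier (free_group m)" "\<And>k. s !! k \<in> carrier (free_group m)"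
  shows "walk m x s k \<in> carrier (free_group m)"
  using assms foldr_push_closed by (induction k) (auto simp: free_group_sel(2))

lemma walk_translate:
  assumes "g \<in> carrier (free_group m)" "x \<in> carrier (free_group m)"
    and "\<And>k. s !! k \<in> carrier (free_group m)"
  shows "walk m (g \<otimes>\<^bsub>free_group m\<^esub> x) s k = g \<otimes>\<^bsub>free_group m\<^esub> walk m x s k"
proof -
  interpret group "free_group m" by (rule group_free_group)
  show ?thesis
    using assms(1,2,3) walk_in_carrier[OF assms(2,3)] by (induction k) (simp_all add: m_assoc)
qed

lemma hat_walk: "hat (walk m x s k) = walk m (hat x) (smap hat s) k"
  by (induction k) (simp_all add: hat_mult)

section \<open>Barriers and gates\<close>

text \<open>The combinatorial content of the barrier condition.  The endpoint of a path counts as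
  visited, so that the point \<open>b\<close> itself needs no separate treatment.\<close>

definition blocks :: "nat \<Rightarrow> word set \<Rightarrow> word \<Rightarrow> word \<Rightarrow> bool" where
  "blocks m S b g \<longleftrightarrow>
     (\<forall>ss\<in>lists S. endpoint m [] ss \<in> C_fin m g \<longrightarrow> (\<exists>k\<le>length ss. endpoint m [] (take k ss) = b))"

text \<open>The barrier hypotheses speak of the generators only; this lemma supplies the inverse generators.\<close>

lemma blocks_hat:
  assumes "blocks m S b g" "g \<in> carrier (free_group m)" "hat ` S \<subseteq> S"
  shows "blocks m S (hat b) (hat g)"
  unfolding blocks_def
proof (intro ballI impI)
  fix ss assume ss: "ss \<in> lists S" "endpoint m [] ss \<in> C_fin m (hat g)"
  have e: "endpoint m [] (map hat ts) = hat (endpoint m [] ts)" for ts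
    by (simp add: hat_endpoint) (simp add: hat_def)
  have "endpoint m [] (map hat ss) \<in> C_fin m g"
    using ss(2) hat_in_C_fin[OF assms(2), of "hat (endpoint m [] ss)"] by (simp add: e hat_hat)
  moreover have "map hat ss \<in> lists S" using ss(1) assms(3) by fastforce
  ultimately obtain k where "k \<le> length ss" "endpoint m [] (take k (map hat ss)) = b"
    using assms(1) by (auto simp: blocks_def)
  then show "\<exists>k\<le>length ss. endpoint m [] (take k ss) = hat b"
    by (auto simp: take_map e hat_hat)
qed

text \<open>Admissibility in the language of paths: every element of the group can be reached from the
identity.\<close>

lemma path_of_semigroup_span:
  assumes "x \<in> semigroup_span (free_group m) S" "S \<subseteq> carrier (free_group m)"
  shows "\<exists>ss\<in>lists S. endpoint m [] ss = x"
  using assms(1)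
proof induction
  case (incl s)
  then have "endpoint m [] [s] = s" by (simp add: endpoint_def free_group_sel(2))
  with incl show ?case by (intro bexI[of _ "[s]"]) auto
next
  case (mult x y)
  then obtain ss ts where st: "ss \<in> lists S" "endpoint m [] ss = x" "ts \<in> lists S" "endpoint m [] ts = y"
    by blast
  have x: "x \<in> carrier (free_group m)"
    using st(1) assms(2) endpoint_in_carrier[of "[]" m ss] by (auto simp: st(2)[symmetric] free_group_sel(1))
  have "foldr push x [] = x" using x by (intro foldr_push_Nil) (simp add: free_group_sel(1))
  then have "endpoint m x ts = x \<otimes>\<^bsub>free_group m\<^esub> y"
    using endpoint_translate[of x m "[]" ts] x st assms(2) by (auto simp: free_group_sel)
  then show ?case using st by (intro bexI[of _ "ss @ ts"]) (auto simp: endpoint_append)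
qed

text \<open>A barrier at \<open>y\<close> controls one direction of the edge between the identity and \<open>y\<close>.  A second one at
\<open>y\<^sup>-\<^sup>1\<close> controls, after translation by \<open>y\<close>, the other direction, and only both together make the edge a gate
for paths from arbitrary starting points.\<close>

locale gated_letter =
  fixes m :: nat and S :: "word set" and y :: letter
  assumes S_carrier: "S \<subseteq> carrier (free_group m)"
    and generates: "semigroup_span (free_group m) S = carrier (free_group m)"
    and letter: "[y] \<in> carrier (free_group m)"
    and gate: "blocks m S [y] [y]"
    and gate_flip: "blocks m S [flip y] [flip y]"
begin

sublocale group "free_group m" by (rule group_free_group)

text \<open>A shortest path from the identity to a point that is not beyond \<open>y\<close> does not visit \<open>y\<close>.  Indeed, the part of the
path after a visit to \<open>y\<close>, translated by \<open>y\<^sup>-\<^sup>1\<close>, leads from the identity to a point beyond \<open>y\<^sup>-\<^sup>1\<close>, so it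
visits \<open>y\<^sup>-\<^sup>1\<close>.  The original path thus returns to the identity, and everything up to this return
can be cut off.\<close>

lemma path_avoiding_letter:
  assumes "ss \<in> lists S" "endpoint m [] ss \<notin> C_fin m [y]"
  shows "\<exists>ts\<in>lists S. endpoint m [] ts = endpoint m [] ss \<and>
           (\<forall>k\<le>length ts. endpoint m [] (take k ts) \<noteq> [y])"
  using assms
proof (induction "length ss" arbitrary: ss rule: less_induct)
  case less
  show ?case
  proof (cases "\<exists>k\<le>length ss. endpoint m [] (take k ss) = [y]")
    case False
    then show ?thesis using less.prems(1) by blast
  next
    case True
    then obtain k where k: "k \<le> length ss" "endpoint m [] (take k ss) = [y]" by blast
    define ts where "ts = drop k ss"
    have cS: "set us \<subseteq> carrier (free_group m)" if "us \<in> lists S" for us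
      using that S_carrier by auto
    have ts: "ts \<in> lists S" using less.prems(1) by (auto simp: ts_def dest: in_set_dropD)
    have x: "endpoint m [] ss = endpoint m [y] ts"
      using k by (metis append_take_drop_id endpoint_append ts_def)
    have y1: "[flip y] \<otimes>\<^bsub>free_group m\<^esub> [y] = []" "[y] \<otimes>\<^bsub>free_group m\<^esub> [flip y] = []"
      by (simp_all add: free_group_sel(2))
    have e: "[] \<in> carrier (free_group m)" by (simp add: free_group_sel(1))
    have tr: "endpoint m [] us = [flip y] \<otimes>\<^bsub>free_group m\<^esub> endpoint m [y] us" if "us \<in> lists S" for us
      using endpoint_translate[of "[flip y]" m "[y]" us] flip_letter_in_carrier[OF letter] letter cS[OF that]
      by (simp only: y1)
    have xc: "endpoint m [] ss \<in> carrier (free_group m)"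
      by (rule endpoint_in_carrier[OF e cS[OF less.prems(1)]])
    have "endpoint m [] ts \<in> C_fin m [flip y]"
      unfolding tr[OF ts] x[symmetric] letter_mult_in_C_fin_flip[OF letter xc] by (rule less.prems(2))
    then obtain l where l: "l \<le> length ts" "endpoint m [] (take l ts) = [flip y]"
      using gate_flip ts by (auto simp: blocks_def)
    have tl: "take l ts \<in> lists S" using ts by (auto dest: in_set_takeD)
    have y2: "[y] \<otimes>\<^bsub>free_group m\<^esub> [] = [y]" by (simp add: free_group_sel(2))
    have "endpoint m [y] (take l ts) = [y] \<otimes>\<^bsub>free_group m\<^esub> [flip y]"
      using endpoint_translate[of "[y]" m "[]" "take l ts"] letter e cS[OF tl] l(2)
      by (simp only: y2)
    then have "endpoint m [y] (take l ts) = []" by (simp only: y1)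
    then have fin: "endpoint m [] (drop l ts) = endpoint m [] ss"
      using x by (metis append_take_drop_id endpoint_append)
    have "k \<noteq> 0" using k(2) by (metis endpoint_Nil list.distinct(1) take0)
    then have shorter: "length (drop l ts) < length ss" using k(1) by (simp add: ts_def)
    have "drop l ts \<in> lists S" using ts by (auto dest: in_set_dropD)
    from less.hyps[OF shorter this] fin less.prems(2) show ?thesis by simp
  qed
qed

text \<open>The barrier at \<open>y\<close> constrains only paths from the identity.  It applies to a step from an arbitrary
\<open>x\<close> because \<open>x\<close> can be reached from the identity without using up the visit to \<open>y\<close>.\<close>

lemma enters_only_at_letter:
  assumes x: "x \<in> carrier (free_group m)" "x \<notin> C_fin m [y]"
    and s: "s \<in> S" "x \<otimes>\<^bsub>free_group m\<^esub> s \<in> C_fin m [y]"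
  shows "x \<otimes>\<^bsub>free_group m\<^esub> s = [y]"
proof -
  obtain ss where "ss \<in> lists S" "endpoint m [] ss = x"
    using path_of_semigroup_span[OF _ S_carrier] x(1) generates by blast
  with path_avoiding_letter x(2) obtain ts where ts: "ts \<in> lists S" "endpoint m [] ts = x"
      and avoid: "\<forall>k\<le>length ts. endpoint m [] (take k ts) \<noteq> [y]"
    by metis
  have "ts @ [s] \<in> lists S" "endpoint m [] (ts @ [s]) = x \<otimes>\<^bsub>free_group m\<^esub> s"
    using ts s by (auto simp: endpoint_snoc)
  with gate s(2) obtain k where k: "k \<le> Suc (length ts)" "endpoint m [] (take k (ts @ [s])) = [y]"
    unfolding blocks_def by (metis length_append_singleton)
  have "k = Suc (length ts)"
    using k avoid by (metis append_Nil2 diff_is_0_eq' le_SucE take0 take_append)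
  with k(2) ts(2) show ?thesis by (simp add: endpoint_snoc)
qed

end


section \<open>Convergence to the boundary\<close>

text \<open>Two points of a geodesic ray are as far apart as their lengths differ, so nothing cancels on the way from one to
the other.\<close>

lemma boundary_iff:
  "\<xi> \<in> boundary m \<longleftrightarrow>
     (\<forall>n. \<xi> n \<in> carrier (free_group m) \<and> length (\<xi> n) = n) \<and> (\<forall>k. \<forall>j\<le>k. take j (\<xi> k) = \<xi> j)"
proof -
  interpret group "free_group m" by (rule group_free_group)
  show ?thesis
  proof
    assume \<xi>: "\<xi> \<in> boundary m"
    then have c: "\<xi> n \<in> carrier (free_group m)" for n by (auto simp: boundary_def)
    have dist: "length (inv\<^bsub>free_group m\<^esub> \<xi> j \<otimes>\<^bsub>free_group m\<^esub> \<xi> k) = k - j" if "j \<le> k" for j k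
      using \<xi> that by (auto simp: boundary_def)
    have l: "length (\<xi> n) = n" for n
      using dist[of 0 n] \<xi> c[of n] by (simp add: boundary_def)
    have "take j (\<xi> k) = \<xi> j" if "j \<le> k" for j k
    proof -
      define v where "v = inv\<^bsub>free_group m\<^esub> \<xi> j \<otimes>\<^bsub>free_group m\<^esub> \<xi> k"
      have v: "v \<in> carrier (free_group m)" "\<xi> k = \<xi> j \<otimes>\<^bsub>free_group m\<^esub> v"
        unfolding v_def using c by (simp_all add: m_assoc[symmetric])
      have "length v = k - j" using dist[OF that] by (simp only: v_def)
      then have "length (\<xi> j \<otimes>\<^bsub>free_group m\<^esub> v) = length (\<xi> j) + length v"
        using l[of k] l[of j] that by (simp add: v(2)[symmetric])
      then have "\<xi> k \<in> C_fin m (\<xi> j)"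
        using v unfolding C_fin_def by blast
      then show ?thesis using C_fin_iff_take[OF c] l by simp
    qed
    with c l show "(\<forall>n. \<xi> n \<in> carrier (free_group m) \<and> length (\<xi> n) = n) \<and>
      (\<forall>k. \<forall>j\<le>k. take j (\<xi> k) = \<xi> j)" by blast
  next
    assume *: "(\<forall>n. \<xi> n \<in> carrier (free_group m) \<and> length (\<xi> n) = n) \<and>
      (\<forall>k. \<forall>j\<le>k. take j (\<xi> k) = \<xi> j)"
    have "length (inv\<^bsub>free_group m\<^esub> \<xi> j \<otimes>\<^bsub>free_group m\<^esub> \<xi> k) = k - j" if "j \<le> k" for j k
    proof -
      have "\<xi> k \<in> C_fin m (\<xi> j)" using * that C_fin_iff_take by simp
      then obtain v where v: "\<xi> k = \<xi> j \<otimes>\<^bsub>free_group m\<^esub> v" "v \<in> carrier (free_group m)"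
          "length (\<xi> k) = length (\<xi> j) + length v"
        by (auto simp: C_fin_def)
      have "inv\<^bsub>free_group m\<^esub> \<xi> j \<otimes>\<^bsub>free_group m\<^esub> \<xi> k = v"
        using v * inv_solve_left'[of v "\<xi> j" "\<xi> k"] by auto
      then show ?thesis using v(3) * by simp
    qed
    moreover have "\<xi> 0 = []" using * by auto
    ultimately show "\<xi> \<in> boundary m" using * by (auto simp: boundary_def free_group_sel(3))
  qed
qed

lemma C_fin_unique:
  assumes "w \<in> C_fin m g" "w \<in> C_fin m h" "length g = length h"
    and "g \<in> carrier (free_group m)" "h \<in> carrier (free_group m)"
  shows "g = h"
  using assms C_fin_iff_take by metis

text \<open>Convergence, stated without the limit: prefixes of every length are eventually constant.  In this form the
event of convergence is visibly a countable combination of events on single positions.\<close>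

lemma converges_to_iff_prefixes:
  "(\<exists>\<xi>\<in>boundary m. converges_to m X \<xi>) \<longleftrightarrow>
     (\<forall>n. \<exists>g\<in>carrier (free_group m). length g = n \<and> (\<forall>\<^sub>F k in sequentially. X k \<in> C_fin m g))"
proof
  assume "\<exists>\<xi>\<in>boundary m. converges_to m X \<xi>"
  then obtain \<xi> where "\<xi> \<in> boundary m" "\<forall>n. \<forall>\<^sub>F k in sequentially. X k \<in> C_fin m (\<xi> n)"
    by (auto simp: converges_to_def)
  then have "length (\<xi> n) = n" "\<xi> n \<in> carrier (free_group m)"
      "\<forall>\<^sub>F k in sequentially. X k \<in> C_fin m (\<xi> n)" for n
    by (simp_all add: boundary_iff)
  then show "\<forall>n. \<exists>g\<in>carrier (free_group m). length g = n \<and> (\<forall>\<^sub>F k in sequentially. X k \<in> C_fin m g)"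
    by blast
next
  assume "\<forall>n. \<exists>g\<in>carrier (free_group m). length g = n \<and> (\<forall>\<^sub>F k in sequentially. X k \<in> C_fin m g)"
  then obtain \<xi> where \<xi>: "\<xi> n \<in> carrier (free_group m)" "length (\<xi> n) = n"
      "\<forall>\<^sub>F k in sequentially. X k \<in> C_fin m (\<xi> n)" for n
    by metis
  have "take j (\<xi> n) = \<xi> j" if "j \<le> n" for j n
  proof -
    obtain k where k: "X k \<in> C_fin m (\<xi> n)" "X k \<in> C_fin m (\<xi> j)"
      using eventually_happens'[OF _ eventually_conj[OF \<xi>(3)[of n] \<xi>(3)[of j]]] by auto
    then have "take n (X k) = \<xi> n" "take j (X k) = \<xi> j"
      using C_fin_iff_take \<xi>(1,2) by auto
    then show ?thesis using that by (metis min_absorb1 take_take)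
  qed
  then have "\<xi> \<in> boundary m" using \<xi> boundary_iff by blast
  then show "\<exists>\<xi>\<in>boundary m. converges_to m X \<xi>" using \<xi>(3) by (auto simp: converges_to_def)
qed

lemma limit_point_eqI:
  assumes "\<xi> \<in> boundary m" "converges_to m X \<xi>"
  shows "limit_point m X = \<xi>"
proof -
  have "\<eta> = \<xi>" if \<eta>: "\<eta> \<in> boundary m" "converges_to m X \<eta>" for \<eta>
  proof
    fix n
    have "\<forall>\<^sub>F k in sequentially. X k \<in> C_fin m (\<eta> n) \<and> X k \<in> C_fin m (\<xi> n)"
      using assms(2) \<eta>(2) by (auto simp: converges_to_def intro: eventually_conj)
    then obtain k where k: "X k \<in> C_fin m (\<eta> n)" "X k \<in> C_fin m (\<xi> n)"
      using eventually_happens'[OF sequentially_bot] by blast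
    show "\<eta> n = \<xi> n"
      by (rule C_fin_unique[OF k]) (use assms(1) \<eta>(1) in \<open>auto simp: boundary_iff\<close>)
  qed
  then have "(THE \<xi>. \<xi> \<in> boundary m \<and> converges_to m X \<xi>) = \<xi>"
    using assms by (intro the_equality) blast+
  moreover have "\<exists>\<xi>\<in>boundary m. converges_to m X \<xi>" using assms by blast
  ultimately show ?thesis unfolding limit_point_def by (simp only: if_True)
qed

lemma limit_point_in_cylinder_iff:
  assumes "g \<in> carrier (free_group m)" "\<exists>\<xi>\<in>boundary m. converges_to m X \<xi>"
  shows "limit_point m X \<in> cylinder m g \<longleftrightarrow> (\<forall>\<^sub>F k in sequentially. X k \<in> C_fin m g)"
proof -
  obtain \<xi> where \<xi>: "\<xi> \<in> boundary m" "converges_to m X \<xi>" using assms(2) by blast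
  have "g \<in> range \<xi> \<longleftrightarrow> g = \<xi> (length g)" using \<xi>(1) by (auto simp: boundary_iff)
  moreover have "g = \<xi> (length g)" if ev: "\<forall>\<^sub>F k in sequentially. X k \<in> C_fin m g"
  proof -
    have "\<forall>\<^sub>F k in sequentially. X k \<in> C_fin m g \<and> X k \<in> C_fin m (\<xi> (length g))"
      using ev \<xi>(2) by (auto simp: converges_to_def intro: eventually_conj)
    then obtain k where k: "X k \<in> C_fin m g" "X k \<in> C_fin m (\<xi> (length g))"
      using eventually_happens'[OF sequentially_bot] by blast
    show ?thesis
      by (rule C_fin_unique[OF k]) (use assms(1) \<xi>(1) in \<open>auto simp: boundary_iff\<close>)
  qed
  moreover have "\<forall>\<^sub>F k in sequentially. X k \<in> C_fin m g" if "g = \<xi> (length g)"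
    using \<xi>(2) that unfolding converges_to_def by metis
  ultimately show ?thesis
    using \<xi> by (auto simp: limit_point_eqI[OF \<xi>] cylinder_def)
qed

lemma gen_powers_in_boundary: "m \<ge> 1 \<Longrightarrow> (\<lambda>n. gen 1 [^]\<^bsub>free_group m\<^esub> n) \<in> boundary m"
  unfolding boundary_iff using gen_pow_in_carrier[of 1 m] by (auto simp: gen_pow min_def)

lemma limit_point_in_boundary: "m \<ge> 1 \<Longrightarrow> limit_point m X \<in> boundary m"
  using gen_powers_in_boundary limit_point_eqI unfolding limit_point_def by (metis (lifting))

text \<open>In a tree, a path with bounded steps that leaves every ball cannot change its prefixes
  forever: a step far away from the root does not touch the initial letters.\<close>

lemma bounded_steps_converge:
  assumes X: "\<And>k. X k \<in> carrier (free_group m)" "\<And>k. X (Suc k) = X k \<otimes>\<^bsub>free_group m\<^esub> t k"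
    and t: "\<And>k. t k \<in> carrier (free_group m)" "\<And>k. length (t k) \<le> c"
    and escape: "\<And>n. \<forall>\<^sub>F k in sequentially. n \<le> length (X k)"
  shows "\<exists>\<xi>\<in>boundary m. converges_to m X \<xi>"
  unfolding converges_to_iff_prefixes
proof
  fix n
  obtain K where K: "\<And>k. k \<ge> K \<Longrightarrow> n + c \<le> length (X k)"
    using escape[of "n + c"] by (auto simp: eventually_sequentially)
  have const: "take n (X (K + k)) = take n (X K)" for k
  proof (induction k)
    case (Suc k)
    have "take n (X (K + k) \<otimes>\<^bsub>free_group m\<^esub> t (K + k)) = take n (X (K + k))"
      using K[of "K + k"] t(2)[of "K + k"] by (intro take_mult_short X t) simp
    with Suc X(2)[of "K + k"] show ?case by simp
  qed simp
  have pre: "take n (X K) \<in> carrier (free_group m)"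
  proof -
    have "take n (X K) @ drop n (X K) \<in> carrier (free_group m)" using X(1) by simp
    then show ?thesis
      by (auto simp only: free_group_sel(1) reduced_word_def successively_append_iff set_append
          image_Un mem_Collect_eq Un_subset_iff)
  qed
  have "X k \<in> C_fin m (take n (X K))" if "k \<ge> K" for k
    using C_fin_iff_take[OF pre] X(1) const[of "k - K"] that K[OF that] K[of K] by simp
  then show "\<exists>g\<in>carrier (free_group m). length g = n \<and> (\<forall>\<^sub>F k in sequentially. X k \<in> C_fin m g)"
    using pre K[of K] by (intro bexI[of _ "take n (X K)"]) (auto simp: eventually_sequentially)
qed

lemma finite_words_of_bounded_length: "finite {w \<in> carrier (free_group m). length w \<le> n}"
proof (rule finite_subset)
  show "{w \<in> carrier (free_group m). length w \<le> n} \<subseteq>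
      {w. set w \<subseteq> {1..m} \<times> UNIV \<and> length w \<le> n}"
    by (force simp: free_group_sel(1))
qed (simp add: finite_lists_length_le)

section \<open>The walk as a random process\<close>

lemma endpoint_take_stake: "j \<le> k \<Longrightarrow> endpoint m x (take j (stake k s)) = walk m x s j"
  by (simp add: walk_eq_endpoint take_stake min_def)

locale free_group_walk =
  fixes m :: nat and \<mu> :: "word pmf"
  assumes support_in_carrier: "set_pmf \<mu> \<subseteq> carrier (free_group m)"
begin

sublocale group "free_group m" by (rule group_free_group)

sublocale prob_space "increments \<mu>"
  by (rule prob_space.prob_space_stream_space[OF prob_space_measure_pmf])

lemma space_increments [simp]: "space (increments \<mu>) = UNIV"
  by (simp add: space_stream_space)

lemma Collect_in_events: "Measurable.pred (increments \<mu>) P \<Longrightarrow> {s. P s} \<in> events"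
  by (simp add: pred_def)

lemma measurable_stake_increments [measurable]:
  "stake k \<in> measurable (increments \<mu>) (count_space UNIV)"
proof -
  have "sets (increments \<mu>) = sets (stream_space (count_space UNIV))"
    by (rule sets_stream_space_cong) simp
  then show ?thesis using measurable_stake measurable_cong_sets by blast
qed

lemma measurable_walk [measurable]:
  "(\<lambda>s. walk m x s k) \<in> measurable (increments \<mu>) (count_space UNIV)"
  unfolding walk_eq_endpoint by measurable

lemma AE_increments_in_support: "AE s in increments \<mu>. \<forall>k. s !! k \<in> set_pmf \<mu>"
proof -
  have "AE s in increments \<mu>. stream_all (\<lambda>x. x \<in> set_pmf \<mu>) s"
    by (rule prob_space.AE_stream_all[OF prob_space_measure_pmf]) (auto simp: AE_measure_pmf)
  then show ?thesis by (simp add: sset_range)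
qed

lemma AE_increments_in_carrier: "AE s in increments \<mu>. \<forall>k. s !! k \<in> carrier (free_group m)"
  using AE_increments_in_support by eventually_elim (use support_in_carrier in auto)

text \<open>The first \<open>k\<close> increments are independent of the later ones, which have the law of the whole sequence.\<close>

lemma emeasure_stake_sdrop:
  assumes [measurable]: "A \<in> sets (increments \<mu>)"
  shows "emeasure (increments \<mu>) {s. Q (stake k s) \<and> sdrop k s \<in> A} =
    emeasure (increments \<mu>) {s. Q (stake k s)} * emeasure (increments \<mu>) A"
proof (induction k arbitrary: Q)
  case 0
  then show ?case
    using emeasure_space_1 by (cases "Q []") auto
next
  case (Suc k)
  have meas: "{s. R (stake j s) \<and> sdrop j s \<in> B} \<in> sets (increments \<mu>)"
    if [measurable]: "B \<in> sets (increments \<mu>)" for R j B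
    by (rule Collect_in_events) measurable
  have "emeasure (increments \<mu>) {s. Q (stake (Suc k) s) \<and> sdrop (Suc k) s \<in> B} =
     (\<integral>\<^sup>+ t. emeasure (increments \<mu>) {s. Q (t # stake k s) \<and> sdrop k s \<in> B} \<partial>measure_pmf \<mu>)"
    if "B \<in> sets (increments \<mu>)" for B
    using prob_space.emeasure_stream_space[OF prob_space_measure_pmf meas[OF that, of Q "Suc k"]] by simp
  note step = this
  have "emeasure (increments \<mu>) {s. Q (stake (Suc k) s) \<and> sdrop (Suc k) s \<in> A} =
     (\<integral>\<^sup>+ t. emeasure (increments \<mu>) {s. Q (t # stake k s)} * emeasure (increments \<mu>) A \<partial>measure_pmf \<mu>)"
    unfolding step[OF assms] by (intro nn_integral_cong Suc.IH)
  also have "\<dots> = (\<integral>\<^sup>+ t. emeasure (increments \<mu>) {s. Q (t # stake k s)} \<partial>measure_pmf \<mu>)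
      * emeasure (increments \<mu>) A"
    by (rule nn_integral_multc) simp
  also have "(\<integral>\<^sup>+ t. emeasure (increments \<mu>) {s. Q (t # stake k s)} \<partial>measure_pmf \<mu>) =
      emeasure (increments \<mu>) {s. Q (stake (Suc k) s)}"
    using step[OF sets.top] by simp
  finally show ?case .
qed

text \<open>The strong Markov property.  A stopping time is given by the set \<open>Q\<close> of initial segments
  at which the process is stopped.\<close>

lemma prob_stopped:
  assumes [measurable]: "A \<in> sets (increments \<mu>)"
    and unique: "\<And>s k l. Q (stake k s) \<Longrightarrow> Q (stake l s) \<Longrightarrow> k = l"
  shows "prob {s. \<exists>k. Q (stake k s) \<and> sdrop k s \<in> A} = prob {s. \<exists>k. Q (stake k s)} * prob A"
proof -
  have meas: "{s. Q (stake k s) \<and> sdrop k s \<in> B} \<in> events"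
    if [measurable]: "B \<in> events" for k B
    by (rule Collect_in_events) measurable
  have sums: "(\<lambda>k. prob {s. Q (stake k s)} * prob B) sums prob {s. \<exists>k. Q (stake k s) \<and> sdrop k s \<in> B}"
    if B: "B \<in> events" for B
  proof -
    have "disjoint_family (\<lambda>k. {s. Q (stake k s) \<and> sdrop k s \<in> B})"
      using unique by (auto simp: disjoint_family_on_def)
    then have "(\<lambda>k. prob {s. Q (stake k s) \<and> sdrop k s \<in> B}) sums
        prob (\<Union>k. {s. Q (stake k s) \<and> sdrop k s \<in> B})"
      using meas[OF B] by (intro finite_measure_UNION) auto
    moreover have "(\<Union>k. {s. Q (stake k s) \<and> sdrop k s \<in> B}) = {s. \<exists>k. Q (stake k s) \<and> sdrop k s \<in> B}"
      by auto
    moreover have "prob {s. Q (stake k s) \<and> sdrop k s \<in> B} = prob {s. Q (stake k s)} * prob B" for k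
      using emeasure_stake_sdrop[OF B, of Q k] by (simp add: measure_def enn2real_mult)
    ultimately show ?thesis by simp
  qed
  have "(\<lambda>k. prob {s. Q (stake k s)}) sums prob {s. \<exists>k. Q (stake k s)}"
    using sums[OF sets.top] prob_space by simp
  then have "(\<lambda>k. prob {s. Q (stake k s)} * prob A) sums (prob {s. \<exists>k. Q (stake k s)} * prob A)"
    by (rule sums_mult2)
  then show ?thesis using sums[OF assms(1)] by (rule sums_unique2[symmetric])
qed

text \<open>The lower bound \<open>n\<close> makes first hits (\<open>n = 0\<close>) and first returns (\<open>n = 1\<close>) instances of one stopping
  time.\<close>

definition first_visit :: "word \<Rightarrow> word \<Rightarrow> word set \<Rightarrow> nat \<Rightarrow> nat \<Rightarrow> word stream \<Rightarrow> bool" where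
  "first_visit x y B n k s \<longleftrightarrow> n \<le> k \<and> walk m x s k = y \<and>
     (\<forall>j<k. walk m x s j \<notin> B \<and> (n \<le> j \<longrightarrow> walk m x s j \<noteq> y))"

lemma ex_first_visit_iff:
  "(\<exists>k. first_visit x y B n k s) \<longleftrightarrow> (\<exists>k\<ge>n. walk m x s k = y \<and> (\<forall>j<k. walk m x s j \<notin> B))"
proof
  assume "\<exists>k\<ge>n. walk m x s k = y \<and> (\<forall>j<k. walk m x s j \<notin> B)" (is "\<exists>k. ?P k")
  define k where "k = (LEAST k. ?P k)"
  have "?P k" unfolding k_def by (rule LeastI_ex) fact
  moreover have "\<not> ?P j" if "j < k" for j using not_less_Least that unfolding k_def by blast
  ultimately show "\<exists>k. first_visit x y B n k s"
    unfolding first_visit_def by (intro exI[of _ k]) auto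
qed (auto simp: first_visit_def)

lemma prob_first_visit_then:
  assumes "A \<in> events"
  shows "prob {s. \<exists>k. first_visit x y B n k s \<and> sdrop k s \<in> A} =
    prob {s. \<exists>k\<ge>n. walk m x s k = y \<and> (\<forall>j<k. walk m x s j \<notin> B)} * prob A"
proof -
  define Q where "Q ss \<longleftrightarrow> n \<le> length ss \<and> endpoint m x ss = y \<and>
     (\<forall>j<length ss. endpoint m x (take j ss) \<notin> B \<and>
        (n \<le> j \<longrightarrow> endpoint m x (take j ss) \<noteq> y))" for ss
  have Q: "Q (stake k s) \<longleftrightarrow> first_visit x y B n k s" for k s
    unfolding Q_def first_visit_def by (auto simp: endpoint_take_stake walk_eq_endpoint[symmetric])
  have "k = l" if "first_visit x y B n k s" "first_visit x y B n l s" for k l s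
    using that unfolding first_visit_def by (metis nat_neq_iff)
  then show ?thesis
    using prob_stopped[OF assms, of Q] unfolding Q ex_first_visit_iff by blast
qed

lemma first_passage_avoiding_eq_prob:
  assumes "y \<notin> B"
  shows "first_passage_avoiding m \<mu> x y B = prob {s. \<exists>k. walk m x s k = y \<and> (\<forall>j<k. walk m x s j \<notin> B)}"
proof -
  let ?E = "\<lambda>k. {s. walk m x s k = y \<and> (\<forall>j<k. walk m x s j \<noteq> y \<and> walk m x s j \<notin> B)}"
  have E: "?E k = {s. first_visit x y B 0 k s}" for k by (auto simp: first_visit_def)
  have "?E k \<in> events" for k
    by (rule Collect_in_events) measurable
  then have "range ?E \<subseteq> events" by auto
  moreover have "disjoint_family ?E"
    unfolding disjoint_family_on_def by (auto) (metis nat_neq_iff)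
  ultimately have "(\<lambda>k. prob (?E k)) sums prob (\<Union>k. ?E k)"
    by (rule finite_measure_UNION)
  moreover have "(\<Union>k. ?E k) = {s. \<exists>k. walk m x s k = y \<and> (\<forall>j<k. walk m x s j \<notin> B)}"
    using ex_first_visit_iff[of x y B 0] unfolding E by auto
  ultimately show ?thesis
    using assms by (simp add: first_passage_avoiding_def sums_iff)
qed

lemma first_passage_eq_prob: "first_passage m \<mu> x y = prob {s. \<exists>k. walk m x s k = y}"
  using first_passage_avoiding_eq_prob[of y "{}" x]
  by (simp add: first_passage_avoiding_def first_passage_def)

text \<open>The two events agree only almost surely: the multiplication is associative on reduced words, and
increments are reduced words on a set of full measure.\<close>

lemma first_passage_translate:
  assumes "g \<in> carrier (free_group m)" "x \<in> carrier (free_group m)" "y \<in> carrier (free_group m)"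
  shows "first_passage m \<mu> (g \<otimes>\<^bsub>free_group m\<^esub> x) (g \<otimes>\<^bsub>free_group m\<^esub> y) = first_passage m \<mu> x y"
  unfolding first_passage_eq_prob
proof (rule finite_measure_eq_AE)
  show "AE s in increments \<mu>. s \<in> {s. \<exists>k. walk m (g \<otimes>\<^bsub>free_group m\<^esub> x) s k = g \<otimes>\<^bsub>free_group m\<^esub> y} \<longleftrightarrow>
      s \<in> {s. \<exists>k. walk m x s k = y}"
    using AE_increments_in_carrier
  proof eventually_elim
    case (elim s)
    have "walk m (g \<otimes>\<^bsub>free_group m\<^esub> x) s k = g \<otimes>\<^bsub>free_group m\<^esub> y \<longleftrightarrow> walk m x s k = y" for k
      using elim assms walk_in_carrier[of x m s k] walk_translate[of g m x s k] by simp
    then show ?case by simp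
  qed
qed (rule Collect_in_events; measurable)+

end


context free_group_walk
begin

section \<open>Transience and the hitting measure\<close>

lemma visited_infinitely_often_shift:
  assumes "walk m x s k = y"
  shows "(\<forall>n. \<exists>l\<ge>n. walk m x s l = z) \<longleftrightarrow> (\<forall>n. \<exists>l\<ge>n. walk m y (sdrop k s) l = z)"
proof
  assume *: "\<forall>n. \<exists>l\<ge>n. walk m x s l = z"
  show "\<forall>n. \<exists>l\<ge>n. walk m y (sdrop k s) l = z"
  proof
    fix n
    obtain l where "l \<ge> k + n" "walk m x s l = z" using * by blast
    then show "\<exists>l\<ge>n. walk m y (sdrop k s) l = z"
      using walk_add[of m x s k "l - k"] assms by (intro exI[of _ "l - k"]) auto
  qed
next
  assume *: "\<forall>n. \<exists>l\<ge>n. walk m y (sdrop k s) l = z"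
  show "\<forall>n. \<exists>l\<ge>n. walk m x s l = z"
  proof
    fix n
    obtain l where "l \<ge> n" "walk m y (sdrop k s) l = z" using * by blast
    then show "\<exists>l\<ge>n. walk m x s l = z"
      using walk_add[of m x s k l] assms by (intro exI[of _ "k + l"]) auto
  qed
qed

text \<open>Let \<open>q\<close> be the probability that the walk from \<open>y\<close> visits \<open>y\<close> infinitely often, and \<open>r < 1\<close> the
probability of a return.  Stopping at the first return gives \<open>q = r q\<close>, hence \<open>q = 0\<close>.\<close>

lemma finitely_many_visits:
  assumes "transient m \<mu>" "y \<in> carrier (free_group m)"
  shows "AE s in increments \<mu>. \<exists>n. \<forall>k\<ge>n. walk m x s k \<noteq> y"
proof -
  define A where "A = {s. \<forall>n. \<exists>k\<ge>n. walk m y s k = y}"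
  have A [measurable]: "A \<in> events" unfolding A_def by (rule Collect_in_events) measurable
  have visit: "{s. \<exists>k. first_visit z y {} n k s \<and> sdrop k s \<in> A} = {s. \<forall>n. \<exists>k\<ge>n. walk m z s k = y}"
    for z n
  proof -
    have "(\<exists>k. first_visit z y {} n k s \<and> sdrop k s \<in> A) \<longleftrightarrow> (\<forall>n. \<exists>k\<ge>n. walk m z s k = y)" for s
    proof -
      have "sdrop k s \<in> A \<longleftrightarrow> (\<forall>n. \<exists>k\<ge>n. walk m z s k = y)" if "first_visit z y {} n k s" for k
        using visited_infinitely_often_shift[of z s k y y] that by (simp add: A_def first_visit_def)
      moreover have "\<exists>k. first_visit z y {} n k s" if "\<forall>n. \<exists>k\<ge>n. walk m z s k = y"
        using that by (simp add: ex_first_visit_iff)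
      ultimately show ?thesis by blast
    qed
    then show ?thesis by blast
  qed
  have "prob {s. \<exists>k. first_visit y y {} 1 k s \<and> sdrop k s \<in> A} =
      prob {s. \<exists>k\<ge>1. walk m y s k = y} * prob A"
    using prob_first_visit_then[OF A, of y y "{}" 1] by simp
  then have "prob A = prob {s. \<exists>k\<ge>1. walk m y s k = y} * prob A"
    unfolding visit by (simp add: A_def)
  moreover have "prob {s. \<exists>k\<ge>1. walk m y s k = y} < 1"
    using assms by (simp add: transient_def)
  ultimately have "prob A = 0" by auto
  then have "prob {s. \<forall>n. \<exists>k\<ge>n. walk m x s k = y} = 0"
    using prob_first_visit_then[OF A, of x y "{}" 0] unfolding visit by simp
  moreover have "{s. \<forall>n. \<exists>k\<ge>n. walk m x s k = y} \<in> events"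
    by (rule Collect_in_events) measurable
  ultimately have "AE s in increments \<mu>. s \<notin> {s. \<forall>n. \<exists>k\<ge>n. walk m x s k = y}"
    by (simp add: prob_eq_0)
  then show ?thesis by eventually_elim auto
qed

text \<open>Balls are finite, so a transient walk eventually leaves each of them for good, and bounded steps turn
this escape into convergence.\<close>

lemma AE_converges:
  assumes "transient m \<mu>" "\<And>t. t \<in> set_pmf \<mu> \<Longrightarrow> length t \<le> c"
  shows "AE s in increments \<mu>. \<exists>\<xi>\<in>boundary m. converges_to m (walk m [] s) \<xi>"
proof -
  have "AE s in increments \<mu>. \<forall>y. y \<in> carrier (free_group m) \<longrightarrow> (\<exists>n. \<forall>k\<ge>n. walk m [] s k \<noteq> y)"
    using finitely_many_visits[OF assms(1)] by (subst AE_all_countable) auto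
  with AE_increments_in_support show ?thesis
  proof eventually_elim
    case (elim s)
    have t: "s !! k \<in> carrier (free_group m)" for k using elim(1) support_in_carrier by auto
    have X: "walk m [] s k \<in> carrier (free_group m)" for k
      using walk_in_carrier[of "[]" m s] t by (simp add: free_group_sel(1))
    have "\<forall>\<^sub>F k in sequentially. n \<le> length (walk m [] s k)" for n
    proof -
      have "\<forall>\<^sub>F k in sequentially. \<forall>y\<in>{w \<in> carrier (free_group m). length w \<le> n}. walk m [] s k \<noteq> y"
        by (subst eventually_ball_finite_distrib[OF finite_words_of_bounded_length])
           (use elim(2) in \<open>auto simp: eventually_sequentially\<close>)
      then show ?thesis by eventually_elim (use X nle_le in blast)
    qed
    then show ?case
      using bounded_steps_converge[of "walk m [] s" m "\<lambda>k. s !! k" c] X t assms(2) elim(1) by simp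
  qed
qed

text \<open>By \<open>hitting_measure_cylinder\<close> below, this is the hitting measure of the cylinder of \<open>g\<close> when the walk
converges.  It is easier to handle, being expressed by the walk itself.\<close>

definition end_prob :: "word \<Rightarrow> real" where
  "end_prob g = prob {s. \<forall>\<^sub>F k in sequentially. walk m [] s k \<in> C_fin m g}"

lemma end_event: "{s. \<forall>\<^sub>F k in sequentially. walk m [] s k \<in> C_fin m g} \<in> events"
  unfolding eventually_sequentially by (rule Collect_in_events) measurable

text \<open>On the event of convergence, the limit point lies in the cylinder of \<open>g\<close> exactly if the walk
eventually stays in the cone of \<open>g\<close>; off this event it is a fixed ray.\<close>

lemma limit_point_measurable:
  assumes "m \<ge> 1"
  shows "(\<lambda>s. limit_point m (walk m [] s)) \<in> measurable (increments \<mu>) (boundary_space m)"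
  unfolding boundary_space_def
proof (rule measurable_measure_of)
  show "cylinder m ` carrier (free_group m) \<subseteq> Pow (boundary m)" by (auto simp: cylinder_def)
  show "(\<lambda>s. limit_point m (walk m [] s)) \<in> space (increments \<mu>) \<rightarrow> boundary m"
    using limit_point_in_boundary[OF assms] by auto
  fix C assume "C \<in> cylinder m ` carrier (free_group m)"
  then obtain g where g: "g \<in> carrier (free_group m)" "C = cylinder m g" by blast
  define V where "V s \<longleftrightarrow> (\<forall>n. \<exists>g. g \<in> carrier (free_group m) \<and> length g = n \<and>
      (\<exists>K. \<forall>k\<ge>K. walk m [] s k \<in> C_fin m g))" for s
  have V: "V s \<longleftrightarrow> (\<exists>\<xi>\<in>boundary m. converges_to m (walk m [] s) \<xi>)" for s
    unfolding V_def converges_to_iff_prefixes eventually_sequentially by blast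
  define d where "d \<longleftrightarrow> (\<lambda>n. gen 1 [^]\<^bsub>free_group m\<^esub> (n::nat)) \<in> C"
  have "limit_point m (walk m [] s) \<in> C \<longleftrightarrow>
      (if V s then \<exists>K. \<forall>k\<ge>K. walk m [] s k \<in> C_fin m g else d)" for s
    using limit_point_in_cylinder_iff[OF g(1), of "walk m [] s"] V[of s] g(2)
    by (simp add: eventually_sequentially d_def limit_point_def)
  then have "(\<lambda>s. limit_point m (walk m [] s)) -` C \<inter> space (increments \<mu>) =
      {s. if V s then \<exists>K. \<forall>k\<ge>K. walk m [] s k \<in> C_fin m g else d}"
    by (simp add: vimage_def)
  also have "\<dots> \<in> events"
    unfolding V_def by (rule Collect_in_events) measurable
  finally show "(\<lambda>s. limit_point m (walk m [] s)) -` C \<inter> space (increments \<mu>) \<in> events" .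
qed

lemma hitting_measure_cylinder:
  assumes "m \<ge> 1" "g \<in> carrier (free_group m)"
    and conv: "AE s in increments \<mu>. \<exists>\<xi>\<in>boundary m. converges_to m (walk m [] s) \<xi>"
  shows "measure (hitting_measure m \<mu>) (cylinder m g) = end_prob g"
proof -
  have C: "cylinder m g \<in> sets (boundary_space m)"
    unfolding boundary_space_def using assms(2)
    by (subst sets_measure_of) (auto simp: cylinder_def)
  have "measure (hitting_measure m \<mu>) (cylinder m g) =
      prob ((\<lambda>s. limit_point m (walk m [] s)) -` cylinder m g \<inter> space (increments \<mu>))"
    unfolding hitting_measure_def free_group_sel(3)
    by (rule measure_distr[OF limit_point_measurable[OF assms(1)] C])
  also have "\<dots> = end_prob g"
    unfolding end_prob_def
  proof (rule finite_measure_eq_AE)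
    show "AE s in increments \<mu>.
        s \<in> (\<lambda>s. limit_point m (walk m [] s)) -` cylinder m g \<inter> space (increments \<mu>) \<longleftrightarrow>
        s \<in> {s. \<forall>\<^sub>F k in sequentially. walk m [] s k \<in> C_fin m g}"
      using conv by eventually_elim (simp add: limit_point_in_cylinder_iff[OF assms(2)])
    show "(\<lambda>s. limit_point m (walk m [] s)) -` cylinder m g \<inter> space (increments \<mu>) \<in> events"
      using limit_point_measurable[OF assms(1)] C by (rule measurable_sets)
  qed (rule end_event)
  finally show ?thesis .
qed

section \<open>Paths have positive probability\<close>

lemma emeasure_initial_segment:
  "emeasure (increments \<mu>) {s. stake (length xs) s = xs} = (\<Prod>x\<leftarrow>xs. ennreal (pmf \<mu> x))"
proof (induction xs)
  case Nil
  then show ?case using emeasure_space_1 by simp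
next
  case (Cons x xs)
  have meas: "{s. stake (length ys) s = ys} \<in> events" for ys
    by (rule Collect_in_events) measurable
  have "emeasure (increments \<mu>) {s. stake (length (x # xs)) s = x # xs} =
      (\<integral>\<^sup>+ t. emeasure (increments \<mu>) {s. t = x \<and> stake (length xs) s = xs} \<partial>measure_pmf \<mu>)"
    using prob_space.emeasure_stream_space[OF prob_space_measure_pmf meas[of "x # xs"]] by simp
  also have "\<dots> = (\<integral>\<^sup>+ t. emeasure (increments \<mu>) {s. stake (length xs) s = xs} * indicator {x} t
      \<partial>measure_pmf \<mu>)"
    by (intro nn_integral_cong) (auto split: split_indicator)
  also have "\<dots> = (\<Prod>x\<leftarrow>x # xs. ennreal (pmf \<mu> x))"
    by (simp add: nn_integral_cmult_indicator Cons emeasure_pmf_single) (rule mult.commute)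
  finally show ?case .
qed

lemma prob_initial_segment_pos:
  assumes "ss \<in> lists (set_pmf \<mu>)"
  shows "prob {s. stake (length ss) s = ss} > 0"
proof -
  have "(\<Prod>x\<leftarrow>ss. ennreal (pmf \<mu> x)) \<noteq> 0"
    using assms by (induction ss) (auto simp: set_pmf_iff)
  then have "prob {s. stake (length ss) s = ss} \<noteq> 0"
    using emeasure_initial_segment[of ss] by (auto simp: emeasure_eq_measure)
  then show ?thesis by (simp add: zero_less_measure_iff)
qed

text \<open>A path in the support that violates the barrier is followed with positive probability.\<close>

lemma barrier_imp_blocks:
  assumes "barrier m \<mu> g {b}"
  shows "blocks m (set_pmf \<mu>) b g"
  unfolding blocks_def
proof (intro ballI impI, rule ccontr)
  fix ss assume ss: "ss \<in> lists (set_pmf \<mu>)" "endpoint m [] ss \<in> C_fin m g"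
    and no: "\<not> (\<exists>k\<le>length ss. endpoint m [] (take k ss) = b)"
  let ?h = "endpoint m [] ss"
  let ?E = "{s. \<exists>k. walk m [] s k = ?h \<and> (\<forall>j<k. walk m [] s j \<notin> {b})}"
  have "?h \<noteq> b" using no by (metis order_refl take_all)
  moreover have "first_passage_avoiding m \<mu> [] ?h {b} = 0"
    using assms ss(2) by (simp add: barrier_def free_group_sel(3))
  ultimately have "prob ?E = 0" by (simp add: first_passage_avoiding_eq_prob)
  moreover have "{s. stake (length ss) s = ss} \<subseteq> ?E"
  proof safe
    fix s assume s: "stake (length ss) s = ss"
    have "walk m [] s j = endpoint m [] (take j ss)" if "j \<le> length ss" for j
      using endpoint_take_stake[OF that, of m "[]" s] s by simp
    then show "\<exists>k. walk m [] s k = ?h \<and> (\<forall>j<k. walk m [] s j \<notin> {b})"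
      using no by (intro exI[of _ "length ss"]) auto
  qed
  moreover have "?E \<in> events" by (rule Collect_in_events) measurable
  ultimately have "prob {s. stake (length ss) s = ss} \<le> 0"
    using finite_measure_mono[of "{s. stake (length ss) s = ss}" ?E] by linarith
  then show False using prob_initial_segment_pos[OF ss(1)] by simp
qed

section \<open>The symmetry\<close>

lemma pmf_hat:
  assumes "antisymmetric m \<mu>"
  shows "pmf \<mu> (hat g) = pmf \<mu> g"
proof (cases "g \<in> carrier (free_group m)")
  case True
  then show ?thesis using assms by (simp add: antisymmetric_def)
next
  case False
  then have "g \<notin> set_pmf \<mu>" "hat g \<notin> set_pmf \<mu>"
    using support_in_carrier hat_in_carrier_iff by blast+
  then show ?thesis by (simp add: set_pmf_iff)
qed

lemma hat_set_pmf: "antisymmetric m \<mu> \<Longrightarrow> hat ` set_pmf \<mu> \<subseteq> set_pmf \<mu>"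
  using pmf_hat by (auto simp: set_pmf_iff)

lemma measurable_smap_hat [measurable]: "smap hat \<in> measurable (increments \<mu>) (increments \<mu>)"
  by measurable

text \<open>The symmetry acts on the increments one by one, so it preserves the probability of each finite initial
segment, and these determine the law.\<close>

lemma distr_smap_hat:
  assumes "antisymmetric m \<mu>"
  shows "distr (increments \<mu>) (increments \<mu>) (smap hat) = increments \<mu>"
proof (rule stream_space_eq_sstart[where S = UNIV])
  show "prob_space (distr (increments \<mu>) (increments \<mu>) (smap hat))"
    by (rule prob_space_distr) measurable
  have sets: "sets (increments \<mu>) = sets (stream_space (count_space UNIV))"
    by (rule sets_stream_space_cong) simp
  show "sets (distr (increments \<mu>) (increments \<mu>) (smap hat)) = sets (stream_space (count_space UNIV))"
    using sets by simp
  show "sets (increments \<mu>) = sets (stream_space (count_space UNIV))" by (rule sets)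
  fix xs :: "word list"
  have start: "sstart UNIV ys = {s. stake (length ys) s = ys}" for ys :: "word list"
  proof -
    have "s \<in> sstart UNIV ys \<longleftrightarrow> stake (length ys) s = ys" for s
      by (induction ys arbitrary: s) auto
    then show ?thesis by blast
  qed
  have meas: "{s. stake (length xs) s = xs} \<in> events" by (rule Collect_in_events) measurable
  have "smap hat -` {s. stake (length xs) s = xs} = {s. stake (length (map hat xs)) s = map hat xs}"
    by (auto simp: map_idI hat_hat) (metis hat_hat list.map_comp list.map_id0 comp_apply eq_id_iff id_apply)+
  then have "emeasure (distr (increments \<mu>) (increments \<mu>) (smap hat)) {s. stake (length xs) s = xs} =
      (\<Prod>x\<leftarrow>map hat xs. ennreal (pmf \<mu> x))"
    using meas emeasure_initial_segment[of "map hat xs"] by (simp add: emeasure_distr)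
  also have "\<dots> = emeasure (increments \<mu>) {s. stake (length xs) s = xs}"
    by (simp add: emeasure_initial_segment pmf_hat[OF assms] comp_def)
  finally show "emeasure (distr (increments \<mu>) (increments \<mu>) (smap hat)) (sstart UNIV xs) =
      emeasure (increments \<mu>) (sstart UNIV xs)"
    unfolding start .
qed (auto intro: prob_space_axioms)

lemma prob_smap_hat:
  assumes "antisymmetric m \<mu>" "{s. P s} \<in> events"
  shows "prob {s. P (smap hat s)} = prob {s. P s}"
proof -
  have "prob {s. P s} = measure (distr (increments \<mu>) (increments \<mu>) (smap hat)) {s. P s}"
    by (simp add: distr_smap_hat[OF assms(1)])
  also have "\<dots> = prob {s. P (smap hat s)}"
    using assms(2) by (simp add: measure_distr vimage_def)
  finally show ?thesis ..
qed

lemma walk_Nil_smap_hat: "walk m [] (smap hat s) k = hat (walk m [] s k)"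
  using hat_walk[of m "[]" s k] by (simp add: hat_def)

lemma end_prob_hat:
  assumes "antisymmetric m \<mu>" "g \<in> carrier (free_group m)"
  shows "end_prob (hat g) = end_prob g"
  using prob_smap_hat[OF assms(1) end_event[of "hat g"]]
  by (simp add: end_prob_def walk_Nil_smap_hat hat_in_C_fin[OF assms(2)])

lemma first_passage_hat:
  assumes "antisymmetric m \<mu>"
  shows "first_passage m \<mu> [] (hat g) = first_passage m \<mu> [] g"
proof -
  have "{s. \<exists>k. walk m [] s k = hat g} \<in> events" by (rule Collect_in_events) measurable
  moreover have "hat w = hat g \<longleftrightarrow> w = g" for w by (metis hat_hat)
  ultimately show ?thesis
    using prob_smap_hat[OF assms, of "\<lambda>s. \<exists>k. walk m [] s k = hat g"]
    by (simp add: first_passage_eq_prob walk_Nil_smap_hat)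
qed

section \<open>First passage decompositions\<close>

text \<open>The strong Markov property at the first visit to \<open>g\<close>, which almost every path that visits \<open>h\<close> has
made before.\<close>

lemma first_passage_through:
  assumes "first_passage_avoiding m \<mu> x h {g} = 0" "h \<noteq> g"
  shows "first_passage m \<mu> x h = first_passage m \<mu> x g * first_passage m \<mu> g h"
proof -
  define A where "A = {s. \<exists>k. walk m g s k = h}"
  have A [measurable]: "A \<in> events" unfolding A_def by (rule Collect_in_events) measurable
  let ?E = "{s. \<exists>k. walk m x s k = h \<and> (\<forall>j<k. walk m x s j \<notin> {g})}"
  have E: "?E \<in> events" by (rule Collect_in_events) measurable
  have "prob ?E = 0" using assms by (simp add: first_passage_avoiding_eq_prob)
  then have "AE s in increments \<mu>. s \<notin> ?E" using E by (simp add: prob_eq_0)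
  then have "AE s in increments \<mu>. s \<in> {s. \<exists>k. walk m x s k = h} \<longleftrightarrow>
      s \<in> {s. \<exists>k. first_visit x g {} 0 k s \<and> sdrop k s \<in> A}"
  proof eventually_elim
    case (elim s)
    have "\<exists>k. first_visit x g {} 0 k s \<and> sdrop k s \<in> A" if k: "walk m x s k = h" for k
    proof -
      obtain j where j: "j < k" "walk m x s j = g" using elim k by blast
      then obtain l where l: "first_visit x g {} 0 l s"
        using ex_first_visit_iff[of x g "{}" 0 s] by auto
      then have "l \<le> j" using j(2) unfolding first_visit_def by (metis not_le zero_le)
      then have "walk m g (sdrop l s) (k - l) = h"
        using walk_add[of m x s l "k - l"] l j(1) k by (simp add: first_visit_def)
      then show ?thesis using l by (auto simp: A_def)
    qed
    moreover have "\<exists>k. walk m x s k = h" if "first_visit x g {} 0 k s" "sdrop k s \<in> A" for k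
      using that walk_add[of m x s k] unfolding first_visit_def A_def by auto
    ultimately show ?case by blast
  qed
  moreover have "{s. \<exists>k. walk m x s k = h} \<in> events" by (rule Collect_in_events) measurable
  moreover have "{s. \<exists>k. first_visit x g {} 0 k s \<and> sdrop k s \<in> A} \<in> events"
    unfolding first_visit_def by (rule Collect_in_events) measurable
  ultimately have "prob {s. \<exists>k. walk m x s k = h} =
      prob {s. \<exists>k. first_visit x g {} 0 k s \<and> sdrop k s \<in> A}"
    by (rule finite_measure_eq_AE)
  then show ?thesis
    using prob_first_visit_then[OF A, of x g "{}" 0] by (simp add: first_passage_eq_prob A_def)
qed

text \<open>Translating by \<open>g\<^sup>-\<^sup>1\<close> after the first visit to \<open>g\<close> turns \<open>g\<^sup>k\<^sup>+\<^sup>1\<close> into \<open>g\<^sup>k\<close>.\<close>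

lemma first_passage_power:
  assumes "g \<in> carrier (free_group m)"
    and through: "\<And>k::nat. k \<ge> 2 \<Longrightarrow> first_passage_avoiding m \<mu> [] (g [^]\<^bsub>free_group m\<^esub> k) {g} = 0"
    and ne: "\<And>k::nat. k \<ge> 2 \<Longrightarrow> g [^]\<^bsub>free_group m\<^esub> k \<noteq> g"
  shows "first_passage m \<mu> [] (g [^]\<^bsub>free_group m\<^esub> Suc k) = first_passage m \<mu> [] g ^ Suc k"
proof (induction k)
  case 0
  then show ?case using assms(1) by simp
next
  case (Suc k)
  have gk: "g [^]\<^bsub>free_group m\<^esub> Suc k \<in> carrier (free_group m)" using assms(1) by (rule nat_pow_closed)
  have "first_passage m \<mu> [] (g [^]\<^bsub>free_group m\<^esub> Suc (Suc k)) =
     first_passage m \<mu> [] g * first_passage m \<mu> g (g [^]\<^bsub>free_group m\<^esub> Suc (Suc k))"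
    by (rule first_passage_through) (use through[of "Suc (Suc k)"] ne[of "Suc (Suc k)"] in simp_all)
  also have "first_passage m \<mu> g (g [^]\<^bsub>free_group m\<^esub> Suc (Suc k)) =
      first_passage m \<mu> [] (g [^]\<^bsub>free_group m\<^esub> Suc k)"
    using first_passage_translate[OF assms(1) one_closed gk] nat_pow_Suc2[OF assms(1), of "Suc k"]
      r_one[OF assms(1)] unfolding free_group_sel(3) by metis
  finally show ?case using Suc by simp
qed

lemma rho_eq_first_passage:
  assumes "g \<in> carrier (free_group m)"
    and "\<And>k::nat. k \<ge> 2 \<Longrightarrow> first_passage_avoiding m \<mu> [] (g [^]\<^bsub>free_group m\<^esub> k) {g} = 0"
    and "\<And>k::nat. k \<ge> 2 \<Longrightarrow> g [^]\<^bsub>free_group m\<^esub> k \<noteq> g"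
  shows "rho m \<mu> g = ereal (first_passage m \<mu> [] g)"
proof -
  have F: "first_passage m \<mu> [] g \<ge> 0" by (simp add: first_passage_eq_prob)
  have "root k (first_passage m \<mu> [] (g [^]\<^bsub>free_group m\<^esub> k)) = first_passage m \<mu> [] g" if "k \<ge> 1" for k
    using first_passage_power[OF assms, of "k - 1"] real_root_power_cancel[OF _ F, of k] that by simp
  then have "\<forall>\<^sub>F k in sequentially. ereal (root k (first_passage m \<mu> [] (g [^]\<^bsub>free_group m\<^esub> k))) =
      ereal (first_passage m \<mu> [] g)"
    unfolding eventually_sequentially by (intro exI[of _ 1]) auto
  then show ?thesis
    unfolding rho_def free_group_sel(3)
    by (subst Liminf_eq) (auto intro: Liminf_const simp: Liminf_const)
qed

end


section \<open>Limit points beyond a generator\<close>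

text \<open>A convergent sequence does not oscillate: prefixes of the length of \<open>g\<close> stabilise, so it either stays in
the cone of \<open>g\<close> or stays out of it.\<close>

lemma eventually_in_or_out:
  assumes "\<exists>\<xi>\<in>boundary m. converges_to m X \<xi>" "g \<in> carrier (free_group m)"
  shows "(\<forall>\<^sub>F k in sequentially. X k \<in> C_fin m g) \<longleftrightarrow> \<not> (\<forall>\<^sub>F k in sequentially. X k \<notin> C_fin m g)"
proof -
  obtain h where h: "h \<in> carrier (free_group m)" "length h = length g"
      "\<forall>\<^sub>F k in sequentially. X k \<in> C_fin m h"
    using assms(1) unfolding converges_to_iff_prefixes by blast
  have "\<forall>\<^sub>F k in sequentially. X k \<notin> C_fin m g" if "h \<noteq> g"
    using h(3) by eventually_elim (use C_fin_unique h(1,2) assms(2) that in blast)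
  moreover have "\<not> (\<forall>\<^sub>F k in sequentially. X k \<notin> C_fin m g)"
    if "\<forall>\<^sub>F k in sequentially. X k \<in> C_fin m g"
    using eventually_happens'[OF sequentially_bot eventually_conj[OF that]] by blast
  ultimately show ?thesis using h(3) by blast
qed

lemma hat_letter: "hat [y] = [flip y]"
  by (simp add: hat_def)

context free_group_walk
begin

text \<open>Going back from \<open>y\<close> to the identity amounts to going from the identity to \<open>y\<^sup>-\<^sup>1\<close>, the mirror image of \<open>y\<close>.\<close>

lemma first_passage_letter_back:
  assumes "antisymmetric m \<mu>" "[y] \<in> carrier (free_group m)"
  shows "first_passage m \<mu> [y] [] = first_passage m \<mu> [] [y]"
proof -
  have "first_passage m \<mu> ([flip y] \<otimes>\<^bsub>free_group m\<^esub> [y]) ([flip y] \<otimes>\<^bsub>free_group m\<^esub> []) =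
      first_passage m \<mu> [y] []"
    using flip_letter_in_carrier[OF assms(2)] assms(2)
    by (intro first_passage_translate) (auto simp: free_group_sel(1))
  then show ?thesis
    using first_passage_hat[OF assms(1), of "[y]"] by (simp add: free_group_sel(2) hat_letter)
qed

lemma first_passage_letter_less_1:
  assumes "transient m \<mu>" "antisymmetric m \<mu>" "[y] \<in> carrier (free_group m)"
  shows "first_passage m \<mu> [] [y] < 1"
proof (rule ccontr)
  assume "\<not> first_passage m \<mu> [] [y] < 1"
  then have F: "first_passage m \<mu> [] [y] = 1"
    using prob_le_1 unfolding first_passage_eq_prob by (simp add: order_antisym)
  define A where "A = {s. \<exists>k. walk m [y] s k = []}"
  have A: "A \<in> events" unfolding A_def by (rule Collect_in_events) measurable
  \<comment> \<open>If \<open>y\<close> were visited almost surely, then, by symmetry, so would be the identity from \<open>y\<close>, and the walk would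
be recurrent.\<close>
  have "prob A = 1"
    using first_passage_letter_back[OF assms(2,3)] F unfolding A_def by (simp add: first_passage_eq_prob)
  then have "prob {s. \<exists>k. first_visit [] [y] {} 0 k s \<and> sdrop k s \<in> A} = 1"
    using prob_first_visit_then[OF A, of "[]" "[y]" "{}" 0] F by (simp add: first_passage_eq_prob)
  moreover have "{s. \<exists>k. first_visit [] [y] {} 0 k s \<and> sdrop k s \<in> A} \<subseteq> {s. \<exists>k\<ge>1. walk m [] s k = []}"
  proof safe
    fix s k assume k: "first_visit [] [y] {} 0 k s" and "sdrop k s \<in> A"
    then obtain l where "walk m [y] (sdrop k s) l = []" by (auto simp: A_def)
    then have "walk m [] s (k + l) = []"
      using walk_add[of m "[]" s k l] k by (simp add: first_visit_def)
    moreover have "k \<noteq> 0" using k by (intro notI) (simp add: first_visit_def)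
    ultimately show "\<exists>k\<ge>1. walk m [] s k = []" by (intro exI[of _ "k + l"]) auto
  qed
  moreover have "{s. \<exists>k\<ge>1. walk m [] s k = []} \<in> events" by (rule Collect_in_events) measurable
  ultimately have "prob {s. \<exists>k\<ge>1. walk m [] s k = []} \<ge> 1"
    using finite_measure_mono[of "{s. \<exists>k. first_visit [] [y] {} 0 k s \<and> sdrop k s \<in> A}"
        "{s. \<exists>k\<ge>1. walk m [] s k = []}"] by linarith
  moreover have "prob {s. \<exists>k\<ge>1. walk m [] s k = []} < 1"
    using assms(1) one_closed unfolding transient_def free_group_sel(3) by auto
  ultimately show False by simp
qed

text \<open>Seen from \<open>g\<close>, the ends beyond \<open>g\<close> are those that do not lie beyond \<open>g\<^sup>-\<^sup>1\<close>.\<close>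

lemma prob_hit_and_end_beyond:
  assumes conv: "AE s in increments \<mu>. \<exists>\<xi>\<in>boundary m. converges_to m (walk m [] s) \<xi>"
    and y: "[y] \<in> carrier (free_group m)"
  shows "prob {s. (\<exists>k. walk m [] s k = [y]) \<and> (\<forall>\<^sub>F k in sequentially. walk m [] s k \<in> C_fin m [y])} =
    first_passage m \<mu> [] [y] * (1 - end_prob [flip y])"
proof -
  define A where "A = {s. \<not> (\<forall>\<^sub>F k in sequentially. walk m [] s k \<in> C_fin m [flip y])}"
  have A [measurable]: "A \<in> events"
    unfolding A_def eventually_sequentially by (rule Collect_in_events) measurable
  have "A = space (increments \<mu>) - {s. \<forall>\<^sub>F k in sequentially. walk m [] s k \<in> C_fin m [flip y]}"
    by (auto simp: A_def)
  then have prob_A: "prob A = 1 - end_prob [flip y]"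
    using prob_compl[OF end_event] by (simp add: end_prob_def)
  have "prob {s. (\<exists>k. walk m [] s k = [y]) \<and> (\<forall>\<^sub>F k in sequentially. walk m [] s k \<in> C_fin m [y])} =
      prob {s. \<exists>k. first_visit [] [y] {} 0 k s \<and> sdrop k s \<in> A}"
  proof (rule finite_measure_eq_AE)
    show "AE s in increments \<mu>.
        s \<in> {s. (\<exists>k. walk m [] s k = [y]) \<and> (\<forall>\<^sub>F k in sequentially. walk m [] s k \<in> C_fin m [y])} \<longleftrightarrow>
        s \<in> {s. \<exists>k. first_visit [] [y] {} 0 k s \<and> sdrop k s \<in> A}"
      using conv AE_increments_in_carrier
    proof eventually_elim
      case (elim s)
      let ?X = "walk m [] s"
      have X: "?X k \<in> carrier (free_group m)" for k
        using walk_in_carrier[of "[]" m s] elim(2) by (simp add: free_group_sel(1))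
      have "sdrop k s \<in> A \<longleftrightarrow> (\<forall>\<^sub>F k in sequentially. ?X k \<in> C_fin m [y])"
        if k: "first_visit [] [y] {} 0 k s" for k
      proof -
        have "walk m [] (sdrop k s) l \<in> C_fin m [flip y] \<longleftrightarrow> ?X (l + k) \<notin> C_fin m [y]" for l
        proof -
          have "walk m ([flip y] \<otimes>\<^bsub>free_group m\<^esub> [y]) (sdrop k s) l =
              [flip y] \<otimes>\<^bsub>free_group m\<^esub> walk m [y] (sdrop k s) l"
            using flip_letter_in_carrier[OF y] y elim(2)
            by (intro walk_translate) (auto simp: sdrop_snth)
          also have "walk m [y] (sdrop k s) l = ?X (l + k)"
            using walk_add[of m "[]" s k l] k by (simp add: first_visit_def add.commute)
          finally show ?thesis
            using letter_mult_in_C_fin_flip[OF y X, of "l + k"] by (simp add: free_group_sel(2))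
        qed
        then have "(\<forall>\<^sub>F l in sequentially. walk m [] (sdrop k s) l \<in> C_fin m [flip y]) \<longleftrightarrow>
            (\<forall>\<^sub>F k in sequentially. ?X k \<notin> C_fin m [y])"
          using eventually_sequentially_seg[of "\<lambda>k. ?X k \<notin> C_fin m [y]" k] by simp
        then show ?thesis using eventually_in_or_out[OF elim(1) y] by (simp add: A_def)
      qed
      moreover have "(\<exists>k. ?X k = [y]) \<longleftrightarrow> (\<exists>k. first_visit [] [y] {} 0 k s)"
        by (simp add: ex_first_visit_iff)
      ultimately show ?case by blast
    qed
    show "{s. \<exists>k. first_visit [] [y] {} 0 k s \<and> sdrop k s \<in> A} \<in> events"
      unfolding first_visit_def by (rule Collect_in_events) measurable
    show "{s. (\<exists>k. walk m [] s k = [y]) \<and> (\<forall>\<^sub>F k in sequentially. walk m [] s k \<in> C_fin m [y])} \<in> events"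
      unfolding eventually_sequentially by (rule Collect_in_events) measurable
  qed
  then show ?thesis
    using prob_first_visit_then[OF A, of "[]" "[y]" "{}" 0] prob_A by (simp add: first_passage_eq_prob)
qed

definition unhit_end_prob :: "word \<Rightarrow> real" where
  "unhit_end_prob g =
     prob {s. (\<forall>k. walk m [] s k \<noteq> g) \<and> (\<forall>\<^sub>F k in sequentially. walk m [] s k \<in> C_fin m g)}"

lemma unhit_end_event:
  "{s. (\<forall>k. walk m [] s k \<noteq> g) \<and> (\<forall>\<^sub>F k in sequentially. walk m [] s k \<in> C_fin m g)} \<in> events"
  unfolding eventually_sequentially by (rule Collect_in_events) measurable

lemma end_prob_letter:
  assumes "AE s in increments \<mu>. \<exists>\<xi>\<in>boundary m. converges_to m (walk m [] s) \<xi>"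
    and "antisymmetric m \<mu>" and y: "[y] \<in> carrier (free_group m)"
  shows "end_prob [y] = first_passage m \<mu> [] [y] * (1 - end_prob [y]) + unhit_end_prob [y]"
proof -
  let ?H = "{s. (\<exists>k. walk m [] s k = [y]) \<and> (\<forall>\<^sub>F k in sequentially. walk m [] s k \<in> C_fin m [y])}"
  let ?U = "{s. (\<forall>k. walk m [] s k \<noteq> [y]) \<and> (\<forall>\<^sub>F k in sequentially. walk m [] s k \<in> C_fin m [y])}"
  have "?H \<in> events"
    unfolding eventually_sequentially by (rule Collect_in_events) measurable
  then have "prob (?H \<union> ?U) = prob ?H + prob ?U"
    using unhit_end_event by (intro finite_measure_Union) auto
  moreover have "?H \<union> ?U = {s. \<forall>\<^sub>F k in sequentially. walk m [] s k \<in> C_fin m [y]}" by auto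
  ultimately show ?thesis
    using prob_hit_and_end_beyond[OF assms(1) y] end_prob_hat[OF assms(2) y]
    by (simp add: end_prob_def unhit_end_prob_def hat_letter)
qed

text \<open>The half-trees beyond \<open>y\<close> and beyond \<open>y\<^sup>-\<^sup>1\<close> are disjoint and, by antisymmetry, equally likely.\<close>

lemma end_prob_letter_le_half:
  assumes "antisymmetric m \<mu>" "[y] \<in> carrier (free_group m)"
  shows "end_prob [y] \<le> 1 / 2"
proof -
  let ?E = "\<lambda>g. {s. \<forall>\<^sub>F k in sequentially. walk m [] s k \<in> C_fin m g}"
  have "s \<notin> ?E [y] \<inter> ?E [flip y]" for s
  proof
    assume "s \<in> ?E [y] \<inter> ?E [flip y]"
    then have "\<forall>\<^sub>F k in sequentially. walk m [] s k \<in> C_fin m [y] \<and> walk m [] s k \<in> C_fin m [flip y]"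
      by (auto intro: eventually_conj)
    then obtain k where "walk m [] s k \<in> C_fin m [y]" "walk m [] s k \<in> C_fin m [flip y]"
      using eventually_happens'[OF sequentially_bot] by blast
    then show False
      using C_fin_letter[OF assms(2)] C_fin_letter[OF flip_letter_in_carrier[OF assms(2)]] by simp
  qed
  then have "prob (?E [y] \<union> ?E [flip y]) = end_prob [y] + end_prob [flip y]"
    unfolding end_prob_def by (intro finite_measure_Union end_event) blast
  moreover have "prob (?E [y] \<union> ?E [flip y]) \<le> 1" by (rule prob_le_1)
  ultimately show ?thesis using end_prob_hat[OF assms] by (simp add: hat_letter)
qed

text \<open>To end up beyond \<open>g\<close> the walk must visit some point of the cone of \<open>g\<close>, and of these there are
countably many.\<close>

lemma unhit_end_prob_barrier:
  assumes "barrier m \<mu> g {g}"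
  shows "unhit_end_prob g = 0"
proof -
  let ?E = "\<lambda>h. {s. \<exists>k. walk m [] s k = h \<and> (\<forall>j<k. walk m [] s j \<notin> {g})}"
  have E: "?E h \<in> events" for h by (rule Collect_in_events) measurable
  have "AE s in increments \<mu>. \<forall>h. h \<in> C_fin m g \<and> h \<noteq> g \<longrightarrow> s \<notin> ?E h"
  proof (subst AE_all_countable, intro allI)
    fix h
    have "AE s in increments \<mu>. s \<notin> ?E h" if "h \<in> C_fin m g" "h \<noteq> g"
    proof -
      have "first_passage_avoiding m \<mu> [] h {g} = 0"
        using assms that(1) by (simp add: barrier_def free_group_sel(3))
      then have "prob (?E h) = 0" using that(2) by (simp add: first_passage_avoiding_eq_prob)
      then show ?thesis using E by (simp only: prob_eq_0)
    qed
    then show "AE s in increments \<mu>. h \<in> C_fin m g \<and> h \<noteq> g \<longrightarrow> s \<notin> ?E h" by auto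
  qed
  then have "AE s in increments \<mu>. s \<notin>
      {s. (\<forall>k. walk m [] s k \<noteq> g) \<and> (\<forall>\<^sub>F k in sequentially. walk m [] s k \<in> C_fin m g)}"
  proof eventually_elim
    case (elim s)
    show ?case
    proof safe
      assume never: "\<forall>k. walk m [] s k \<noteq> g"
        and "\<forall>\<^sub>F k in sequentially. walk m [] s k \<in> C_fin m g"
      then obtain k where "walk m [] s k \<in> C_fin m g"
        using eventually_happens'[OF sequentially_bot] by blast
      with elim never show False by blast
    qed
  qed
  then show ?thesis unfolding unhit_end_prob_def using unhit_end_event by (simp only: prob_eq_0)
qed

end

section \<open>Walks with barriers at all generators but one\<close>

locale barrier_walk = free_group_walk +
  fixes i :: nat
  assumes adm: "admissible m \<mu>"
    and trans: "transient m \<mu>"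
    and antisym: "antisymmetric m \<mu>"
    and i: "i \<in> {1..m}"
    and barrier_other: "\<And>j. j \<in> {1..m} \<Longrightarrow> j \<noteq> i \<Longrightarrow> barrier m \<mu> (gen j) {gen j}"
    and barrier_square: "barrier m \<mu> (gen i [^]\<^bsub>free_group m\<^esub> (2::nat)) {gen i}"
begin

text \<open>The hypothesis gives the barrier at \<open>a\<^sub>j\<close>, its mirror image the one at \<open>a\<^sub>j\<^sup>-\<^sup>1\<close>.\<close>

lemma gated:
  assumes "[y] \<in> carrier (free_group m)" "fst y \<noteq> i"
  shows "gated_letter m (set_pmf \<mu>) y"
proof -
  define j where "j = fst y"
  have j: "j \<in> {1..m}" "j \<noteq> i" using assms by (auto simp: letter_in_carrier j_def)
  have "blocks m (set_pmf \<mu>) (gen j) (gen j)"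
    by (rule barrier_imp_blocks[OF barrier_other[OF j]])
  moreover from this have "blocks m (set_pmf \<mu>) (hat (gen j)) (hat (gen j))"
    using gen_in_carrier[OF j(1)] hat_set_pmf[OF antisym] by (intro blocks_hat)
  moreover have "y = (j, True) \<and> flip y = (j, False) \<or> y = (j, False) \<and> flip y = (j, True)"
    by (cases y) (auto simp: j_def flip_def)
  ultimately have "blocks m (set_pmf \<mu>) [y] [y]" "blocks m (set_pmf \<mu>) [flip y] [flip y]"
    by (auto simp: gen_def hat_def flip_def)
  then show ?thesis
    using assms(1) adm by unfold_locales (auto simp: admissible_def)
qed

text \<open>Translation by \<open>w\<^sup>-\<^sup>1\<close> reduces the crossing of the edge between \<open>w\<close> and \<open>w y\<close> to the one between the
identity and \<open>y\<close>.\<close>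

lemma enters_at:
  assumes w: "w @ [y] \<in> carrier (free_group m)" "fst y \<noteq> i"
    and x: "x \<in> carrier (free_group m)" "x \<notin> C_fin m (w @ [y])"
    and t: "t \<in> set_pmf \<mu>" "x \<otimes>\<^bsub>free_group m\<^esub> t \<in> C_fin m (w @ [y])"
  shows "x \<otimes>\<^bsub>free_group m\<^esub> t = w @ [y]"
proof -
  have wc: "w \<in> carrier (free_group m)" and y: "[y] \<in> carrier (free_group m)"
    using w(1) by (auto simp: free_group_sel(1) reduced_word_def successively_append_iff)
  have tc: "t \<in> carrier (free_group m)" using t(1) support_in_carrier by blast
  interpret gated_letter m "set_pmf \<mu>" y by (rule gated[OF y w(2)])
  let ?x = "inv\<^bsub>free_group m\<^esub> w \<otimes>\<^bsub>free_group m\<^esub> x"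
  have assoc: "?x \<otimes>\<^bsub>free_group m\<^esub> t = inv\<^bsub>free_group m\<^esub> w \<otimes>\<^bsub>free_group m\<^esub> (x \<otimes>\<^bsub>free_group m\<^esub> t)"
    using wc x(1) tc by (simp add: m_assoc)
  have "?x \<otimes>\<^bsub>free_group m\<^esub> t = [y]"
  proof (rule enters_only_at_letter)
    show "?x \<in> carrier (free_group m)" using wc x(1) by simp
    show "?x \<notin> C_fin m [y]" using in_C_fin_append_letter[OF w(1) x(1)] x(2) by simp
    show "?x \<otimes>\<^bsub>free_group m\<^esub> t \<in> C_fin m [y]"
      using in_C_fin_append_letter[OF w(1), of "x \<otimes>\<^bsub>free_group m\<^esub> t"] x(1) tc t(2)
      unfolding assoc by simp
  qed fact
  then have "x \<otimes>\<^bsub>free_group m\<^esub> t = w \<otimes>\<^bsub>free_group m\<^esub> [y]"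
    using inv_solve_left'[of "[y]" w "x \<otimes>\<^bsub>free_group m\<^esub> t"] wc y x(1) tc unfolding assoc by simp
  also have "\<dots> = w @ [y]"
    unfolding free_group_sel(2) using w(1) by (intro foldr_push_reduced_append) (simp add: free_group_sel(1))
  finally show ?thesis .
qed

text \<open>Leaving the half-tree beyond \<open>y\<close> is, after translation by \<open>y\<^sup>-\<^sup>1\<close>, entering the half-tree beyond \<open>y\<^sup>-\<^sup>1\<close>.\<close>

lemma leaves_at:
  assumes w: "w @ [y] \<in> carrier (free_group m)" "fst y \<noteq> i"
    and x: "x \<in> C_fin m (w @ [y])"
    and t: "t \<in> set_pmf \<mu>" "x \<otimes>\<^bsub>free_group m\<^esub> t \<notin> C_fin m (w @ [y])"
  shows "x \<otimes>\<^bsub>free_group m\<^esub> t = w"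
proof -
  have wc: "w \<in> carrier (free_group m)" and y: "[y] \<in> carrier (free_group m)"
    using w(1) by (auto simp: free_group_sel(1) reduced_word_def successively_append_iff)
  have tc: "t \<in> carrier (free_group m)" using t(1) support_in_carrier by blast
  have xc: "x \<in> carrier (free_group m)" using x C_fin_iff_take[OF w(1)] by blast
  note fy = flip_letter_in_carrier[OF y]
  interpret gated_letter m "set_pmf \<mu>" "flip y" by (rule gated[OF fy]) (simp add: w(2))
  let ?x = "inv\<^bsub>free_group m\<^esub> w \<otimes>\<^bsub>free_group m\<^esub> x"
  have xc': "?x \<in> carrier (free_group m)" using wc xc by simp
  have assoc: "([flip y] \<otimes>\<^bsub>free_group m\<^esub> ?x) \<otimes>\<^bsub>free_group m\<^esub> t =
      [flip y] \<otimes>\<^bsub>free_group m\<^esub> (inv\<^bsub>free_group m\<^esub> w \<otimes>\<^bsub>free_group m\<^esub> (x \<otimes>\<^bsub>free_group m\<^esub> t))"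
    using wc xc tc fy by (simp add: m_assoc)
  have "([flip y] \<otimes>\<^bsub>free_group m\<^esub> ?x) \<otimes>\<^bsub>free_group m\<^esub> t = [flip y]"
  proof (rule enters_only_at_letter)
    show "[flip y] \<otimes>\<^bsub>free_group m\<^esub> ?x \<in> carrier (free_group m)" using fy xc' by (rule m_closed)
    show "[flip y] \<otimes>\<^bsub>free_group m\<^esub> ?x \<notin> C_fin m [flip y]"
      using letter_mult_in_C_fin_flip[OF y xc'] in_C_fin_append_letter[OF w(1) xc] x by simp
    show "([flip y] \<otimes>\<^bsub>free_group m\<^esub> ?x) \<otimes>\<^bsub>free_group m\<^esub> t \<in> C_fin m [flip y]"
      unfolding assoc
      using letter_mult_in_C_fin_flip[OF y, of "inv\<^bsub>free_group m\<^esub> w \<otimes>\<^bsub>free_group m\<^esub> (x \<otimes>\<^bsub>free_group m\<^esub> t)"]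
        in_C_fin_append_letter[OF w(1), of "x \<otimes>\<^bsub>free_group m\<^esub> t"] t(2) wc xc tc by simp
  qed fact
  then have "[flip y] \<otimes>\<^bsub>free_group m\<^esub> (inv\<^bsub>free_group m\<^esub> w \<otimes>\<^bsub>free_group m\<^esub> (x \<otimes>\<^bsub>free_group m\<^esub> t)) =
      [flip y]"
    unfolding assoc .
  then have "inv\<^bsub>free_group m\<^esub> w \<otimes>\<^bsub>free_group m\<^esub> (x \<otimes>\<^bsub>free_group m\<^esub> t) = \<one>\<^bsub>free_group m\<^esub>"
    using fy wc xc tc by simp
  then show ?thesis
    using inv_solve_left'[of "\<one>\<^bsub>free_group m\<^esub>" w "x \<otimes>\<^bsub>free_group m\<^esub> t"] wc xc tc by simp
qed

text \<open>A letter \<open>b\<close> other than \<open>a\<^sub>i\<close> and its inverse can only be the last one of an increment \<open>t = p b q\<close>: one step leads from the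
identity into the half-tree beyond \<open>p b\<close>, so it lands on \<open>p b\<close>.  All earlier letters are thus \<open>a\<^sub>i\<close> or
its inverse.  Two of them in a row are equal, as \<open>t\<close> is reduced, and a single step would jump over the
barrier for \<open>a\<^sub>i\<^sup>2\<close> or its mirror image.\<close>

lemma support_length:
  assumes "t \<in> set_pmf \<mu>"
  shows "length t \<le> 2"
proof (rule ccontr)
  assume "\<not> length t \<le> 2"
  then obtain a b c u where t: "t = a # b # c # u"
    by (cases t; cases "tl t"; cases "tl (tl t)") auto
  have tc: "a # b # c # u \<in> carrier (free_group m)" using assms support_in_carrier t by blast
  have a: "[a] \<in> carrier (free_group m)" and ab: "[a, b] \<in> carrier (free_group m)" and "b \<noteq> flip a"
    using tc by (auto simp: free_group_sel(1) reduced_Cons)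
  have e: "[] \<in> carrier (free_group m)" by (simp add: free_group_sel(1))
  have et: "[] \<otimes>\<^bsub>free_group m\<^esub> t = t" by (simp add: free_group_sel(2))
  have t_in: "[] \<otimes>\<^bsub>free_group m\<^esub> t \<in> C_fin m [a]" "[] \<otimes>\<^bsub>free_group m\<^esub> t \<in> C_fin m [a, b]"
    unfolding et using C_fin_iff_take[OF a] C_fin_iff_take[OF ab] tc by (simp_all add: t)
  have not_in: "[] \<notin> C_fin m [a]" "[] \<notin> C_fin m [a, b]"
    using C_fin_iff_take[OF a] C_fin_iff_take[OF ab] by simp_all
  have "fst a = i"
  proof (rule ccontr)
    assume "fst a \<noteq> i"
    then have "t = [] @ [a]"
      using enters_at[of "[]" a "[]" t] a e assms t_in(1) not_in(1) unfolding et by simp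
    then show False by (simp add: t)
  qed
  moreover have "fst b = i"
  proof (rule ccontr)
    assume "fst b \<noteq> i"
    then have "t = [a] @ [b]"
      using enters_at[of "[a]" b "[]" t] ab e assms t_in(2) not_in(2) unfolding et by simp
    then show False by (simp add: t)
  qed
  ultimately have "b = a" using \<open>b \<noteq> flip a\<close> by (auto simp: flip_def prod_eq_iff)
  have "blocks m (set_pmf \<mu>) (gen i) (replicate 2 (i, True))"
    using barrier_imp_blocks[OF barrier_square] by (simp add: gen_pow)
  moreover from this have "blocks m (set_pmf \<mu>) (hat (gen i)) (hat (replicate 2 (i, True)))"
    using gen_pow_in_carrier[OF i, of 2] hat_set_pmf[OF antisym]
    by (intro blocks_hat) (simp_all add: gen_pow)
  moreover have "a = (i, True) \<or> a = (i, False)" using \<open>fst a = i\<close> by (cases a) auto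
  ultimately have "blocks m (set_pmf \<mu>) [a] [a, b]"
    using \<open>b = a\<close> by (auto simp: gen_def hat_def flip_def numeral_2_eq_2)
  moreover have "endpoint m [] [t] = t" by (simp add: endpoint_def et)
  moreover have "t \<in> C_fin m [a, b]" using C_fin_iff_take[OF ab] tc by (simp add: t)
  moreover have "[t] \<in> lists (set_pmf \<mu>)" using assms by simp
  ultimately obtain k where k: "k \<le> length [t]" "endpoint m [] (take k [t]) = [a]"
    unfolding blocks_def by metis
  then have "k = 0 \<or> k = 1" by (simp add: le_Suc_eq)
  then show False using k(2) \<open>endpoint m [] [t] = t\<close> t by auto
qed

lemma converges: "AE s in increments \<mu>. \<exists>\<xi>\<in>boundary m. converges_to m (walk m [] s) \<xi>"
  using trans support_length by (rule AE_converges)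

text \<open>If \<open>a\<^sub>i\<close> can be bypassed on the way to a point beyond it, then this happens through some \<open>a\<^sub>i z\<close>, where
\<open>z\<close> is a letter with barriers on both sides.  The half-tree beyond \<open>a\<^sub>i z\<close> has its only exit
at \<open>a\<^sub>i\<close>, so that a walk from \<open>a\<^sub>i z\<close> that never visits \<open>a\<^sub>i\<close> is trapped in it; transience makes this an event of
positive probability.\<close>

lemma unhit_end_prob_pos:
  assumes "\<not> barrier m \<mu> (gen i) {gen i}"
  shows "unhit_end_prob (gen i) > 0"
proof -
  let ?g = "gen i"
  have gc: "?g \<in> carrier (free_group m)" by (rule gen_in_carrier[OF i])
  then have "\<not> (\<forall>h\<in>C_fin m ?g. first_passage_avoiding m \<mu> [] h {?g} = 0)"
    using assms by (auto simp: barrier_def free_group_sel(3) gen_def)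
  then obtain h where h: "h \<in> C_fin m ?g" "first_passage_avoiding m \<mu> [] h {?g} \<noteq> 0" by blast
  have "h \<noteq> ?g" using h(2) by (auto simp: first_passage_avoiding_def)
  have hc: "h \<in> carrier (free_group m)" "take 1 h = ?g" using h(1) C_fin_iff_take[OF gc] by (auto simp: gen_def)
  obtain z u where zu: "h = (i, True) # z # u"
    using hc(2) \<open>h \<noteq> ?g\<close> by (cases h; cases "tl h") (auto simp: gen_def)
  have "h \<notin> C_fin m (?g [^]\<^bsub>free_group m\<^esub> (2::nat))"
    using barrier_square h(2) by (auto simp: barrier_def free_group_sel(3))
  then have "z \<noteq> (i, True)"
    using C_fin_iff_take[OF gen_pow_in_carrier[OF i, of 2], of h] hc(1)
    unfolding gen_pow by (auto simp: zu numeral_2_eq_2)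
  moreover have "z \<noteq> (i, False)" using hc(1) unfolding zu by (auto simp: free_group_sel(1) reduced_Cons flip_def)
  ultimately have zi: "fst z \<noteq> i" by (cases z) auto
  let ?w = "?g @ [z]"
  have wc: "?w \<in> carrier (free_group m)" and zc: "[z] \<in> carrier (free_group m)"
    using hc(1) unfolding zu by (auto simp: free_group_sel(1) reduced_Cons gen_def)
  have hw: "h \<in> C_fin m ?w" using C_fin_iff_take[OF wc, of h] hc(1) by (simp add: gen_def zu)
  have w_sub: "C_fin m ?w \<subseteq> C_fin m ?g"
  proof
    fix x assume "x \<in> C_fin m ?w"
    then have "x \<in> carrier (free_group m)" "take 2 x = [(i, True), z]"
      using C_fin_iff_take[OF wc] by (auto simp: gen_def numeral_2_eq_2)
    then show "x \<in> C_fin m ?g"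
      using C_fin_iff_take[OF gc] by (cases x) (auto simp: gen_def)
  qed
  let ?E = "\<lambda>h. {s. \<exists>k. walk m [] s k = h \<and> (\<forall>j<k. walk m [] s j \<notin> {?g})}"
  have E: "?E h \<in> events" for h by (rule Collect_in_events) measurable
  have carrier_walk: "walk m [] s k \<in> carrier (free_group m)" if "\<forall>k. s !! k \<in> set_pmf \<mu>" for s k
    using walk_in_carrier[of "[]" m s k] that support_in_carrier by (auto simp: free_group_sel(1))
  have "0 < prob (?E h)"
    using h(2) first_passage_avoiding_eq_prob[of h "{?g}" "[]"] \<open>h \<noteq> ?g\<close> by (simp add: zero_less_measure_iff)
  \<comment> \<open>The half-tree beyond \<open>a\<^sub>i z\<close> contains \<open>h\<close> and is entered at \<open>a\<^sub>i z\<close>.\<close>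
  also have "prob (?E h) \<le> prob (?E ?w)"
  proof (rule finite_measure_mono_AE)
    show "AE s in increments \<mu>. s \<in> ?E h \<longrightarrow> s \<in> ?E ?w"
      using AE_increments_in_support
    proof eventually_elim
      case (elim s)
      show ?case
      proof
        assume "s \<in> ?E h"
        then obtain k where k: "walk m [] s k = h" "\<forall>j<k. walk m [] s j \<noteq> ?g" by auto
        define n where "n = (LEAST n. walk m [] s n \<in> C_fin m ?w)"
        have n: "walk m [] s n \<in> C_fin m ?w"
          unfolding n_def by (rule LeastI[of _ k]) (simp add: k(1) hw)
        have "n \<le> k" unfolding n_def by (rule Least_le) (simp add: k(1) hw)
        have "n \<noteq> 0" using n C_fin_iff_take[OF wc] by (intro notI) (simp add: gen_def)
        then obtain l where l: "n = Suc l" by (cases n) auto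
        have "walk m [] s l \<notin> C_fin m ?w"
          using not_less_Least[of l "\<lambda>n. walk m [] s n \<in> C_fin m ?w"] l unfolding n_def by simp
        then have "walk m [] s n = ?w"
          using enters_at[OF wc zi carrier_walk[OF elim], of l "s !! l"] n elim unfolding l by simp
        then show "s \<in> ?E ?w" using k(2) \<open>n \<le> k\<close> by (auto intro!: exI[of _ n])
      qed
    qed
  qed (rule E)
  finally have reach: "prob (?E ?w) > 0" .
  define A where "A = {s. \<forall>k. walk m ?w s k \<noteq> ?g}"
  have A [measurable]: "A \<in> events" unfolding A_def by (rule Collect_in_events) measurable
  have "A = space (increments \<mu>) - {s. \<exists>k. walk m ?w s k = ?g}" by (auto simp: A_def)
  moreover have "{s. \<exists>k. walk m ?w s k = ?g} \<in> events" by (rule Collect_in_events) measurable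
  ultimately have "prob A = 1 - first_passage m \<mu> ?w ?g"
    using prob_compl by (simp add: first_passage_eq_prob)
  also have "first_passage m \<mu> ?w ?g = first_passage m \<mu> [z] []"
  proof -
    have "?g \<otimes>\<^bsub>free_group m\<^esub> [z] = ?w"
      unfolding free_group_sel(2) by (rule foldr_push_reduced_append) (use wc in \<open>simp add: free_group_sel(1)\<close>)
    moreover have "?g \<otimes>\<^bsub>free_group m\<^esub> [] = ?g" by (simp add: free_group_sel(2) gen_def)
    ultimately show ?thesis
      using first_passage_translate[OF gc zc, of "[]"] by (simp add: free_group_sel(1))
  qed
  finally have "prob A > 0"
    using first_passage_letter_back[OF antisym zc] first_passage_letter_less_1[OF trans antisym zc] by simp
  with reach have "0 < prob {s. \<exists>k. first_visit [] ?w {?g} 0 k s \<and> sdrop k s \<in> A}"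
    using prob_first_visit_then[OF A, of "[]" ?w "{?g}" 0] by simp
  also have "\<dots> \<le> unhit_end_prob ?g"
    unfolding unhit_end_prob_def
  proof (rule finite_measure_mono_AE)
    show "AE s in increments \<mu>. s \<in> {s. \<exists>k. first_visit [] ?w {?g} 0 k s \<and> sdrop k s \<in> A} \<longrightarrow>
      s \<in> {s. (\<forall>k. walk m [] s k \<noteq> ?g) \<and> (\<forall>\<^sub>F k in sequentially. walk m [] s k \<in> C_fin m ?g)}"
      using AE_increments_in_support
    proof eventually_elim
      case (elim s)
      show ?case
      proof
        assume "s \<in> {s. \<exists>k. first_visit [] ?w {?g} 0 k s \<and> sdrop k s \<in> A}"
        then obtain k where k: "walk m [] s k = ?w" "\<forall>j<k. walk m [] s j \<noteq> ?g" "sdrop k s \<in> A"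
          by (auto simp: first_visit_def)
        have later: "walk m [] s (k + n) \<noteq> ?g" for n
          using k(3) walk_add[of m "[]" s k n] k(1) by (simp add: A_def)
        have never: "walk m [] s n \<noteq> ?g" for n
          using k(2) later[of "n - k"] by (cases "n < k") auto
        have "walk m [] s (k + n) \<in> C_fin m ?w" for n
        proof (induction n)
          case 0
          then show ?case using k(1) wc C_fin_iff_take[OF wc] by simp
        next
          case (Suc n)
          show ?case
            using leaves_at[OF wc zi Suc, of "s !! (k + n)"] elim never[of "Suc (k + n)"] by auto
        qed
        then have "walk m [] s n \<in> C_fin m ?g" if "n \<ge> k" for n
          using w_sub that by (metis le_Suc_ex subsetD)
        then show "s \<in> {s. (\<forall>k. walk m [] s k \<noteq> ?g) \<and>
            (\<forall>\<^sub>F k in sequentially. walk m [] s k \<in> C_fin m ?g)}"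
          using never by (auto simp: eventually_sequentially)
      qed
    qed
  qed (rule unhit_end_event)
  finally show ?thesis .
qed

text \<open>For \<open>k \<ge> 2\<close> the power \<open>a\<^sub>j\<^sup>k\<close> lies in the cone of \<open>a\<^sub>j\<close> and in that of \<open>a\<^sub>j\<^sup>2\<close>, so either kind of
barrier forces a visit to \<open>a\<^sub>j\<close> first.\<close>

lemma rho_gen:
  assumes j: "j \<in> {1..m}"
  shows "rho m \<mu> (gen j) = ereal (first_passage m \<mu> [] (gen j))"
proof (rule rho_eq_first_passage[OF gen_in_carrier[OF j]])
  fix k :: nat assume k: "k \<ge> 2"
  show "gen j [^]\<^bsub>free_group m\<^esub> k \<noteq> gen j"
    using k unfolding gen_pow by (auto simp: gen_def dest: arg_cong[of _ _ length])
  show "first_passage_avoiding m \<mu> [] (gen j [^]\<^bsub>free_group m\<^esub> k) {gen j} = 0"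
  proof (cases "j = i")
    case True
    then show ?thesis
      using gen_pow_in_C_fin[OF j k] barrier_square by (simp add: barrier_def free_group_sel(3))
  next
    case False
    have "gen j [^]\<^bsub>free_group m\<^esub> k \<in> C_fin m (gen j)"
      using gen_pow_in_C_fin[OF j, of 1 k] k gen_in_carrier[OF j] by simp
    then show ?thesis
      using barrier_other[OF j False] by (simp add: barrier_def free_group_sel(3))
  qed
qed

lemma first_passage_gen:
  assumes j: "j \<in> {1..m}"
  defines "n \<equiv> measure (hitting_measure m \<mu>) (cylinder m (gen j))"
  shows "n < 1" and "n = first_passage m \<mu> [] (gen j) * (1 - n) + unhit_end_prob (gen j)"
proof -
  have c: "[(j, True)] \<in> carrier (free_group m)" using gen_in_carrier[OF j] by (simp add: gen_def)
  have "n = end_prob [(j, True)]"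
    using hitting_measure_cylinder[OF _ c converges] i by (simp add: n_def gen_def)
  then show "n < 1" "n = first_passage m \<mu> [] (gen j) * (1 - n) + unhit_end_prob (gen j)"
    using end_prob_letter[OF converges antisym c] end_prob_letter_le_half[OF antisym c]
    by (simp_all add: gen_def)
qed

end

theorem theorem1p2:
  fixes m i :: nat and \<mu> :: "word pmf"
  assumes "admissible m \<mu>"
    and "transient m \<mu>"
    and "antisymmetric m \<mu>"
    and "i \<in> {1..m}"
    and "\<And>j. j \<in> {1..m} \<Longrightarrow> j \<noteq> i \<Longrightarrow> barrier m \<mu> (gen j) {gen j}"
    and "barrier m \<mu> (gen i [^]\<^bsub>free_group m\<^esub> (2::nat)) {gen i}"
  shows "(\<forall>j\<in>{1..m}. j \<noteq> i \<longrightarrow>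
            rho m \<mu> (gen j) = ereal (first_passage m \<mu> \<one>\<^bsub>free_group m\<^esub> (gen j)) \<and>
            first_passage m \<mu> \<one>\<^bsub>free_group m\<^esub> (gen j) =
              measure (hitting_measure m \<mu>) (cylinder m (gen j)) /
              (1 - measure (hitting_measure m \<mu>) (cylinder m (gen j)))) \<and>
         rho m \<mu> (gen i) = ereal (first_passage m \<mu> \<one>\<^bsub>free_group m\<^esub> (gen i)) \<and>
         first_passage m \<mu> \<one>\<^bsub>free_group m\<^esub> (gen i) \<le>
           measure (hitting_measure m \<mu>) (cylinder m (gen i)) /
           (1 - measure (hitting_measure m \<mu>) (cylinder m (gen i))) \<and>
         (first_passage m \<mu> \<one>\<^bsub>free_group m\<^esub> (gen i) =
            measure (hitting_measure m \<mu>) (cylinder m (gen i)) /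
            (1 - measure (hitting_measure m \<mu>) (cylinder m (gen i)))
          \<longleftrightarrow> barrier m \<mu> (gen i) {gen i})"
proof -
  interpret barrier_walk m \<mu> i
    using assms by unfold_locales (auto simp: admissible_def)
  let ?n = "\<lambda>j. measure (hitting_measure m \<mu>) (cylinder m (gen j))"
  have quotient: "first_passage m \<mu> [] (gen j) = ?n j / (1 - ?n j) - unhit_end_prob (gen j) / (1 - ?n j)"
    if "j \<in> {1..m}" for j
    using first_passage_gen[OF that] by (simp add: diff_divide_distrib[symmetric] eq_divide_eq)
  have "first_passage m \<mu> [] (gen j) = ?n j / (1 - ?n j)" if "j \<in> {1..m}" "j \<noteq> i" for j
    using quotient[OF that(1)] unhit_end_prob_barrier[OF barrier_other[OF that]] by simp
  moreover have "unhit_end_prob (gen i) \<ge> 0" by (simp add: unhit_end_prob_def)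
  then have "first_passage m \<mu> [] (gen i) \<le> ?n i / (1 - ?n i)"
    using quotient[OF i] first_passage_gen(1)[OF i] by simp
  moreover have "first_passage m \<mu> [] (gen i) = ?n i / (1 - ?n i) \<longleftrightarrow> unhit_end_prob (gen i) = 0"
    using quotient[OF i] first_passage_gen(1)[OF i] by simp
  moreover have "unhit_end_prob (gen i) = 0 \<longleftrightarrow> barrier m \<mu> (gen i) {gen i}"
    using unhit_end_prob_barrier unhit_end_prob_pos by fastforce
  ultimately show ?thesis
    unfolding free_group_sel(3) using rho_gen i by blast
qed

end
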